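(* Let $k$ be algebraically closed of characteristic zero and let $L$ be a finite-dimensional solvable Lie algebra over $k$. Let $m$ be the maximum dimension of all abelian ideals of $L$. Then the following are equivalent: (1) $L$ admits a CP; (2) $L$ admits a CP-ideal; (3) $m=\frac12(\dim L+i(L))$.
   Context: For a Lie algebra $L$ and $f\in L^*$, put $L(f)=\{x\in L\mid f([x,y])=0 \text{ for all } y\in L\}$. The index of $L$ is $i(L)=\min_{f\in L^*}\dim L(f)$. A CP (commutative polarization) of $L$ is a commutative Lie subalgebra $P$ which is a polarization with respect to some $f\in L^*$, i.e. $f([P,P])=0$ and $\dim P=\frac12(\dim L+\dim L(f))$; equivalently, a commutative Lie subalgebra $P$ with $\dim P=\frac12(\dim L+i(L))$. A CP-ideal of $L$ is a CP of $L$ which is an ideal of $L$. It is known that $m\le\frac12(\dim L+i(L))$. *)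

theory Defs
  imports Complex_Main "HOL-Computational_Algebra.Polynomial"
begin

text \<open>
  The Lie algebra is the whole type \<open>'a\<close>, seen as a vector space over \<open>'k\<close> by \<open>scale\<close>.
\<close>

locale lie_algebra = vector_space scale
  for scale :: "'k::field \<Rightarrow> 'a::ab_group_add \<Rightarrow> 'a" (infixr \<open>*s\<close> 75) +
  fixes bracket :: "'a \<Rightarrow> 'a \<Rightarrow> 'a"
  assumes bracket_linear_left: "Vector_Spaces.linear (*s) (*s) (\<lambda>x. bracket x y)"
    and bracket_linear_right: "Vector_Spaces.linear (*s) (*s) (bracket x)"
    and bracket_self: "bracket x x = 0"
    and jacobi: "bracket x (bracket y z) + bracket y (bracket z x) + bracket z (bracket x y) = 0"
begin

definition lie_subalgebra :: "'a set \<Rightarrow> bool" where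
  "lie_subalgebra P \<longleftrightarrow> subspace P \<and> (\<forall>x\<in>P. \<forall>y\<in>P. bracket x y \<in> P)"

definition lie_ideal :: "'a set \<Rightarrow> bool" where
  "lie_ideal I \<longleftrightarrow> subspace I \<and> (\<forall>x. \<forall>y\<in>I. bracket x y \<in> I)"

definition commutative :: "'a set \<Rightarrow> bool" where
  "commutative P \<longleftrightarrow> (\<forall>x\<in>P. \<forall>y\<in>P. bracket x y = 0)"

primrec derived_series :: "nat \<Rightarrow> 'a set" where
  "derived_series 0 = UNIV"
| "derived_series (Suc n) = span {bracket x y | x y. x \<in> derived_series n \<and> y \<in> derived_series n}"

definition solvable :: bool where
  "solvable \<longleftrightarrow> (\<exists>n. derived_series n = {0})"

definition dual :: "('a \<Rightarrow> 'k) set" where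
  "dual = {f. Vector_Spaces.linear (*s) (*) f}"

text \<open>The subspace $L(f)$, the radical of the alternating form $(x, y) \mapsto f([x, y])$.\<close>

definition radical :: "('a \<Rightarrow> 'k) \<Rightarrow> 'a set" where
  "radical f = {x. \<forall>y. f (bracket x y) = 0}"

definition index :: nat where
  "index = (LEAST n. \<exists>f\<in>dual. n = dim (radical f))"

definition polarization :: "('a \<Rightarrow> 'k) \<Rightarrow> 'a set \<Rightarrow> bool" where
  "polarization f P \<longleftrightarrow> lie_subalgebra P \<and> (\<forall>x\<in>P. \<forall>y\<in>P. f (bracket x y) = 0) \<and>
     real (dim P) = 1/2 * (real (dim UNIV) + real (dim (radical f)))"

definition CP :: "'a set \<Rightarrow> bool" where
  "CP P \<longleftrightarrow> lie_subalgebra P \<and> commutative P \<and> (\<exists>f\<in>dual. polarization f P)"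

definition CP_ideal :: "'a set \<Rightarrow> bool" where
  "CP_ideal P \<longleftrightarrow> CP P \<and> lie_ideal P"

text \<open>
  In the finite-dimensional case the set below is finite, and it contains \<open>dim {0}\<close>.
\<close>

definition max_abelian_ideal_dim :: nat where
  "max_abelian_ideal_dim = Max {dim I | I. lie_ideal I \<and> commutative I}"

end

end

(*
  If P is a commutative subspace and f is a linear form with dim L(f) minimal, then P is isotropic
  for (x, y) -> f([x, y]), so 2 dim P <= dim L + i(L), and the CPs are exactly the commutative
  subspaces attaining this bound. The only real content is therefore that a solvable L has, for every
  commutative P, an abelian ideal of dimension at least dim P. This is Borel's fixed point
  argument, carried out one generator at a time: climb from 0 to L through subspaces M refining the
  derived series, so that [x, M] lies in M for the next generator x, and replace a commutative
  P normalized by M with a limit of P under one-parameter groups of automorphisms that is also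
  normalized by x. First a torus t^e, where e takes separating natural numbers as
  values on the spectrum of ad x, makes P invariant under the semisimple part of ad x; then exp(t n),
  with n the nilpotent part, makes P invariant under n. Limits are taken algebraically, as spaces of
  leading coefficients of polynomial curves.
*)

theory Submission
  imports Defs
begin

section \<open>Preliminaries and polynomial curves\<close>

text \<open>In general exp(t ad x) is not polynomial in t (over k it need not even make sense), so
  it has no algebraic limit; splitting ad x replaces it by two groups that do. Both parts of ad x
  are derivations and preserve every subspace that ad x preserves: the first fact keeps the moving
  subspaces commutative, the second, with [x, M] in M, keeps the limit normalized by M. The
  eigenvalues lie in a field without order or integrality, so the weights come from a Q-linear
  functional on k that does not vanish on differences of eigenvalues. Making the weights
  nonnegative, as polynomiality demands, shifts them by a constant and turns the automorphism law
  into [g a, g b] = t^c g [a, b]; subspaces do not notice the factor. Limits are taken at t =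
  infinity because every affine map t -> a t + b with a nonzero fixes that point: a = 1/s, b = 0 is
  translation in the torus and a = 1, b = -s translation in exp(t n), so one invariance lemma serves
  both groups.\<close>

text \<open>Gaussian elimination without division, so that it works over polynomial rings as well as
  over fields; with polynomial coefficients it yields the moving combination in
  \<open>dim_le_dim_limit_subspace\<close>.\<close>

lemma homogeneous_system_nontrivial_solution:
  fixes a :: "'i \<Rightarrow> 'j \<Rightarrow> 'r::idom"
  assumes "finite I" "finite J" "card I < card J"
  shows "\<exists>r. (\<exists>j\<in>J. r j \<noteq> 0) \<and> (\<forall>i\<in>I. (\<Sum>j\<in>J. a i j * r j) = 0)"
  using assms
proof (induction I arbitrary: J a rule: finite_induct)
  case empty
  then obtain j0 where "j0 \<in> J" by fastforce
  then show ?case by (intro exI[of _ "\<lambda>_. 1"]) auto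
next
  case (insert i I J a)
  show ?case
  proof (cases "\<forall>j\<in>J. a i j = 0")
    case True
    from insert.IH[of J a] insert.prems insert.hyps
    obtain r where "\<exists>j\<in>J. r j \<noteq> 0" "\<forall>i\<in>I. (\<Sum>j\<in>J. a i j * r j) = 0" by auto
    with True show ?thesis by (intro exI[of _ r]) auto
  next
    case False
    then obtain j0 where j0: "j0 \<in> J" "a i j0 \<noteq> 0" by auto
    let ?J = "J - {j0}"
    have "card I < card ?J" using insert.prems insert.hyps j0 by simp
    with insert.IH[of ?J "\<lambda>l j. a i j0 * a l j - a l j0 * a i j"] insert.prems
    obtain r where r: "\<exists>j\<in>?J. r j \<noteq> 0"
      "\<And>l. l \<in> I \<Longrightarrow> (\<Sum>j\<in>?J. (a i j0 * a l j - a l j0 * a i j) * r j) = 0" by auto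
    \<comment> \<open>Row \<open>i\<close> determines the unknown at \<open>j0\<close>. Multiplying
      all other unknowns by the pivot \<open>a i j0\<close> avoids dividing by it, and in a domain a
      nonzero pivot keeps the solution nontrivial.\<close>
    define s where "s j = (if j = j0 then - (\<Sum>j\<in>?J. a i j * r j) else a i j0 * r j)" for j
    have sum_s: "(\<Sum>j\<in>J. a l j * s j) =
        - a l j0 * (\<Sum>j\<in>?J. a i j * r j) + a i j0 * (\<Sum>j\<in>?J. a l j * r j)" for l
    proof -
      have "(\<Sum>j\<in>?J. a l j * s j) = (\<Sum>j\<in>?J. a i j0 * (a l j * r j))"
        by (rule sum.cong) (auto simp: s_def)
      then show ?thesis
        using insert.prems j0 by (simp add: sum.remove[of J j0] s_def sum_distrib_left sum_negf)
    qed
    have "(\<Sum>j\<in>J. a l j * s j) = 0" if "l \<in> insert i I" for l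
    proof (cases "l = i")
      case True
      then show ?thesis by (simp add: sum_s)
    next
      case False
      with that r(2)[of l] show ?thesis
        by (simp add: sum_s left_diff_distrib sum_subtractf sum_negf sum_distrib_left mult.assoc)
    qed
    moreover have "\<exists>j\<in>J. s j \<noteq> 0" using r(1) j0 by (auto simp: s_def)
    ultimately show ?thesis by blast
  qed
qed

section \<open>Integral weights for finitely many field elements\<close>

lemma vector_space_rat: "vector_space (\<lambda>(q::rat) (x::'k::field_char_0). of_rat q * x)"
  by unfold_locales (simp_all add: algebra_simps of_rat_add of_rat_mult)

text \<open>Characteristic zero makes k a rational vector space, in which a nonzero x is part of a
  basis.\<close>

lemma additive_rat_functional_nonzero:
  fixes x :: "'k::field_char_0"
  assumes "x \<noteq> 0"
  shows "\<exists>\<phi> :: 'k \<Rightarrow> rat. (\<forall>a b. \<phi> (a + b) = \<phi> a + \<phi> b) \<and> \<phi> x \<noteq> 0"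
proof -
  interpret vector_space_pair "\<lambda>(q::rat) (x::'k). of_rat q * x" "(*) :: rat \<Rightarrow> rat \<Rightarrow> rat"
    by (intro vector_space_pair.intro vector_space_rat) (unfold_locales, simp_all add: algebra_simps)
  have "vs1.independent {x}" using assms by simp
  from linear_independent_extend[OF this, of "\<lambda>_. 1"] obtain g where
    g: "Vector_Spaces.linear (\<lambda>(q::rat) (x::'k). of_rat q * x) (*) g" "g x = 1" by auto
  then show ?thesis by (intro exI[of _ g]) (auto simp: linear_add)
qed

lemma additive_rat_functional_nonzero_on:
  fixes S :: "'k::field_char_0 set"
  assumes "finite S" "0 \<notin> S"
  shows "\<exists>\<phi> :: 'k \<Rightarrow> rat. (\<forall>a b. \<phi> (a + b) = \<phi> a + \<phi> b) \<and> (\<forall>x\<in>S. \<phi> x \<noteq> 0)"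
  using assms
proof (induction S rule: finite_induct)
  case empty
  then show ?case by (intro exI[of _ "\<lambda>_. 0"]) auto
next
  case (insert x S)
  then obtain \<phi> :: "'k \<Rightarrow> rat" where \<phi>: "\<And>a b. \<phi> (a + b) = \<phi> a + \<phi> b" "\<And>y. y \<in> S \<Longrightarrow> \<phi> y \<noteq> 0" by auto
  obtain \<psi> :: "'k \<Rightarrow> rat" where \<psi>: "\<And>a b. \<psi> (a + b) = \<psi> a + \<psi> b" "\<psi> x \<noteq> 0"
    using additive_rat_functional_nonzero[of x] insert.prems by auto
  \<comment> \<open>Each \<open>y\<close> with \<open>\<psi> y \<noteq> 0\<close> rules out a single
    \<open>c\<close>, so infinitely many rationals remain. Where \<open>\<psi> y = 0\<close>,
    \<open>y\<close> is an old element and \<open>\<phi> y\<close> decides.\<close>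
  have "finite ((\<lambda>y. - \<phi> y / \<psi> y) ` insert x S \<union> {0})" using insert.hyps by simp
  then obtain c :: rat where c: "c \<notin> (\<lambda>y. - \<phi> y / \<psi> y) ` insert x S \<union> {0}"
    using ex_new_if_finite[OF infinite_UNIV_char_0] by blast
  have "\<phi> y + c * \<psi> y \<noteq> 0" if "y \<in> insert x S" for y
  proof (cases "\<psi> y = 0")
    case True
    with that \<phi>(2) \<psi>(2) show ?thesis by auto
  next
    case False
    show ?thesis
    proof
      assume "\<phi> y + c * \<psi> y = 0"
      with False have "c = - \<phi> y / \<psi> y" by (simp add: field_simps eq_neg_iff_add_eq_0)
      with c that show False by blast
    qed
  qed
  then show ?case
    by (intro exI[of _ "\<lambda>y. \<phi> y + c * \<psi> y"]) (auto simp: \<phi>(1) \<psi>(1) algebra_simps)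
qed

lemma rat_common_denominator:
  fixes \<phi> :: "'k \<Rightarrow> rat"
  assumes "finite S"
  shows "\<exists>d::int. d > 0 \<and> (\<forall>x\<in>S. of_int d * \<phi> x \<in> \<int>)"
  using assms
proof (induction S rule: finite_induct)
  case empty
  show ?case by (intro exI[of _ 1]) auto
next
  case (insert x S)
  then obtain d where d: "d > 0" "\<And>y. y \<in> S \<Longrightarrow> of_int d * \<phi> y \<in> \<int>" by auto
  obtain p q where pq: "q > 0" "\<phi> x = of_int p / of_int q"
    by (metis quotient_of_div quotient_of_denom_pos surj_pair)
  have "of_int (d * q) * \<phi> y \<in> \<int>" if "y \<in> S" for y
    using Ints_mult[OF Ints_of_int[of q] d(2)[OF that]] by (simp add: mult_ac)
  moreover have "of_int (d * q) * \<phi> x \<in> \<int>" using pq by simp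
  ultimately show ?case using d pq by (intro exI[of _ "d * q"]) auto
qed

text \<open>Replaces a maximal torus by a one-parameter subgroup with the same weight spaces.\<close>

lemma separating_nat_weights:
  fixes S :: "'k::field_char_0 set"
  assumes "finite S"
  shows "\<exists>(e :: 'k \<Rightarrow> nat) c. inj_on e S \<and>
    (\<forall>x\<in>S. \<forall>y\<in>S. x + y \<in> S \<longrightarrow> e x + e y = c + e (x + y))"
proof -
  \<comment> \<open>Nonvanishing on differences is injectivity on \<open>S\<close>.\<close>
  let ?D = "(\<lambda>(x, y). x - y) ` (S \<times> S) - {0}"
  obtain \<phi> :: "'k \<Rightarrow> rat" where add: "\<And>a b. \<phi> (a + b) = \<phi> a + \<phi> b"
    and nz: "\<And>x. x \<in> ?D \<Longrightarrow> \<phi> x \<noteq> 0"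
    using additive_rat_functional_nonzero_on[of ?D] assms by (metis (no_types, lifting) DiffD2 finite_Diff finite_SigmaI finite_imageI singletonI)
  obtain d :: int where d: "d > 0" "\<And>x. x \<in> S \<Longrightarrow> of_int d * \<phi> x \<in> \<int>"
    using rat_common_denominator[OF assms, of \<phi>] by auto
  define w where "w x = \<lfloor>of_int d * \<phi> x\<rfloor>" for x
  have w: "of_int (w x) = of_int d * \<phi> x" if "x \<in> S" for x
    unfolding w_def using d(2)[OF that] by (auto simp: Ints_def)
  have inj: "x = y" if "x \<in> S" "y \<in> S" "w x = w y" for x y
  proof (rule ccontr)
    assume "x \<noteq> y"
    with that have "x - y \<in> ?D" by force
    with nz have "\<phi> (x - y) \<noteq> 0" by blast
    moreover have "\<phi> x = \<phi> (x - y) + \<phi> y" using add[of "x - y" y] by simp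
    moreover have "of_int d * \<phi> x = of_int d * \<phi> y" using w that by metis
    ultimately show False using d by simp
  qed
  have w_add: "w (x + y) = w x + w y" if "x \<in> S" "y \<in> S" "x + y \<in> S" for x y
  proof -
    have "(of_int (w (x + y)) :: rat) = of_int (w x + w y)"
      using w[OF that(1)] w[OF that(2)] w[OF that(3)] by (simp add: add algebra_simps)
    then show ?thesis by (simp only: of_int_eq_iff)
  qed
  \<comment> \<open>This \<open>b\<close> lifts all weights to naturals. It enters
    \<open>e x + e y\<close> twice and \<open>e (x + y)\<close> once, so it also becomes the
    constant \<open>c\<close>.\<close>
  define b where "b = (\<Sum>x\<in>S. \<bar>w x\<bar>)"
  have b: "w x + b \<ge> 0" if "x \<in> S" for x
    using member_le_sum[OF that, of "\<lambda>x. \<bar>w x\<bar>"] assms unfolding b_def by force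
  have b0: "b \<ge> 0" unfolding b_def by (simp add: sum_nonneg)
  have "inj_on (\<lambda>x. nat (w x + b)) S"
    by (intro inj_onI inj) (use b in \<open>auto simp: eq_nat_nat_iff\<close>)
  moreover have "nat (w x + b) + nat (w y + b) = nat b + nat (w (x + y) + b)"
    if "x \<in> S" "y \<in> S" "x + y \<in> S" for x y
    using b[OF that(1)] b[OF that(2)] b[OF that(3)] b0 w_add[OF that] by linarith
  ultimately show ?thesis by blast
qed

context finite_dimensional_vector_space
begin

text \<open>Turns membership in \<open>S\<close> into the vanishing of finitely many linear
  coordinates, so that statements on curves in \<open>S\<close> become statements on scalar
  polynomials.\<close>

lemma subspace_adapted_basis:
  assumes "subspace S"
  obtains A B where "A \<subseteq> B" "independent B" "finite B" "span B = UNIV" "span A = S" "card A = dim S"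
    "\<And>v. v \<in> S \<longleftrightarrow> (\<forall>b\<in>B - A. representation B v b = 0)"
proof -
  obtain A where A: "A \<subseteq> S" "independent A" "S \<subseteq> span A" "card A = dim S"
    using basis_exists by blast
  have spA: "span A = S" using A assms by (simp add: span_subspace)
  obtain B where B: "A \<subseteq> B" "independent B" "UNIV \<subseteq> span B"
    using maximal_independent_subset_extend[OF subset_UNIV A(2)] by metis
  have fin: "finite B" using B finiteI_independent by blast
  have spB: "span B = UNIV" using B by blast
  have "v \<in> S \<longleftrightarrow> (\<forall>b\<in>B - A. representation B v b = 0)" for v
  proof
    assume "v \<in> S"
    then have "representation B v = representation A v"
      using representation_extend[OF B(2) _ B(1), of v] spA by simp
    then show "\<forall>b\<in>B - A. representation B v b = 0"
      using representation_ne_zero[of A v] by auto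
  next
    assume z: "\<forall>b\<in>B - A. representation B v b = 0"
    have "v = (\<Sum>b\<in>B. representation B v b *s b)"
      using sum_representation_eq[OF B(2) _ fin order_refl, of v] spB by simp
    also have "\<dots> = (\<Sum>b\<in>A. representation B v b *s b)"
      by (rule sum.mono_neutral_right) (use z fin B in auto)
    also have "\<dots> \<in> span A" by (intro span_sum span_scale span_base)
    finally show "v \<in> S" using spA by simp
  qed
  then show thesis using that[of A B] B fin spB spA A by blast
qed

end

section \<open>Vector-valued polynomial curves\<close>

text \<open>The degree bound is strict: in \<open>t ^ N *s v + F t\<close> with
  \<open>polydeg N F\<close>, the vector \<open>v\<close> is the coefficient of top degree, possibly
  zero.\<close>

definition (in vector_space) polydeg :: "nat \<Rightarrow> ('a \<Rightarrow> 'b) \<Rightarrow> bool" where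
  "polydeg N F \<longleftrightarrow> (\<exists>w. \<forall>t. F t = (\<Sum>i<N. t ^ i *s w i))"

context vector_space
begin

lemma polydeg_mono:
  assumes "polydeg N F" "N \<le> M"
  shows "polydeg M F"
proof -
  obtain w where w: "\<And>t. F t = (\<Sum>i<N. t ^ i *s w i)" using assms by (auto simp: polydeg_def)
  have "F t = (\<Sum>i<M. t ^ i *s (if i < N then w i else 0))" for t
  proof -
    have "(\<Sum>i<M. t ^ i *s (if i < N then w i else 0)) = (\<Sum>i<N. t ^ i *s (if i < N then w i else 0))"
      by (rule sum.mono_neutral_right) (use assms in auto)
    then show ?thesis by (simp add: w)
  qed
  then show ?thesis unfolding polydeg_def by (intro exI[of _ "\<lambda>i. if i < N then w i else 0"]) blast
qed

lemma polydeg_add: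
  assumes "polydeg N F" "polydeg N G"
  shows "polydeg N (\<lambda>t. F t + G t)"
proof -
  obtain w w' where "\<And>t. F t = (\<Sum>i<N. t ^ i *s w i)" "\<And>t. G t = (\<Sum>i<N. t ^ i *s w' i)"
    using assms unfolding polydeg_def by blast
  then show ?thesis
    unfolding polydeg_def
    by (intro exI[of _ "\<lambda>i. w i + w' i"]) (simp add: scale_right_distrib sum.distrib)
qed

lemma polydeg_linear_image:
  assumes "Vector_Spaces.linear scale scale H" "polydeg N F"
  shows "polydeg N (\<lambda>t. H (F t))"
proof -
  interpret H: Vector_Spaces.linear scale scale H by fact
  obtain w where "\<And>t. F t = (\<Sum>i<N. t ^ i *s w i)" using assms by (auto simp: polydeg_def)
  then show ?thesis
    unfolding polydeg_def by (intro exI[of _ "\<lambda>i. H (w i)"]) (simp add: H.sum H.scale)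
qed

lemma polydeg_scale: "polydeg N F \<Longrightarrow> polydeg N (\<lambda>t. c *s F t)"
  by (rule polydeg_linear_image) (simp_all add: linear_scale_self)

lemma polydeg_zero: "polydeg N (\<lambda>t. 0)"
  unfolding polydeg_def by (intro exI[of _ "\<lambda>_. 0"]) simp

lemma polydeg_sum:
  assumes "\<And>i. i \<in> I \<Longrightarrow> polydeg N (F i)"
  shows "polydeg N (\<lambda>t. \<Sum>i\<in>I. F i t)"
  using assms
  by (induction I rule: infinite_finite_induct) (auto intro: polydeg_add polydeg_zero)

lemma polydeg_monom: "n < N \<Longrightarrow> polydeg N (\<lambda>t. t ^ n *s v)"
  unfolding polydeg_def
  by (intro exI[of _ "\<lambda>i. if i = n then v else 0"]) (simp add: if_distrib cong: if_cong)

lemma polydeg_power_scale: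
  assumes "polydeg N F"
  shows "polydeg (n + N) (\<lambda>t. t ^ n *s F t)"
proof -
  obtain w where w: "\<And>t. F t = (\<Sum>i<N. t ^ i *s w i)" using assms by (auto simp: polydeg_def)
  have "polydeg (n + N) (\<lambda>t. \<Sum>i<N. t ^ (n + i) *s w i)"
    by (intro polydeg_sum polydeg_monom) auto
  then show ?thesis by (simp add: w scale_sum_right power_add)
qed

lemma polydeg_poly_scale:
  assumes "polydeg N F"
  shows "\<exists>M. polydeg M (\<lambda>t. poly p t *s F t)"
proof -
  have "polydeg (degree p + N) (\<lambda>t. \<Sum>i\<le>degree p. coeff p i *s (t ^ i *s F t))"
    by (intro polydeg_sum polydeg_scale polydeg_mono[OF polydeg_power_scale[OF assms]]) auto
  then show ?thesis
    by (intro exI[of _ "degree p + N"]) (simp add: poly_altdef scale_sum_left)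
qed

lemma polydeg_sum_ex:
  assumes "finite I" "\<And>i. i \<in> I \<Longrightarrow> \<exists>N. polydeg N (F i)"
  shows "\<exists>N. polydeg N (\<lambda>t. \<Sum>i\<in>I. F i t)"
proof -
  obtain N where N: "\<And>i. i \<in> I \<Longrightarrow> polydeg (N i) (F i)" using assms by metis
  have "polydeg (\<Sum>i\<in>I. N i) (\<lambda>t. \<Sum>i\<in>I. F i t)"
    by (intro polydeg_sum polydeg_mono[OF N] member_le_sum) (use assms in auto)
  then show ?thesis by blast
qed

text \<open>Under t -> a t + b a top coefficient \<open>v\<close> only changes to
  \<open>a ^ N *s v\<close>, and all else stays below degree \<open>N\<close>. This is why limits at
  infinity survive affine reparametrization.\<close>

lemma polydeg_affine:
  assumes "polydeg N F"
  shows "polydeg N (\<lambda>t. F (a * t + b))"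
    and "polydeg N (\<lambda>t. (a * t + b) ^ N *s v - t ^ N *s (a ^ N *s v))"
proof -
  have step: "polydeg (Suc n) (\<lambda>t. (a * t + b) *s K t)" if "polydeg n K" for n K
  proof -
    have "polydeg (Suc n) (\<lambda>t. a *s (t ^ 1 *s K t) + b *s K t)"
      using polydeg_power_scale[OF that, of 1] polydeg_mono[OF that, of "Suc n"]
      by (intro polydeg_add polydeg_scale) auto
    then show ?thesis by (simp add: scale_left_distrib)
  qed
  have lead: "polydeg n (\<lambda>t. (a * t + b) ^ n *s v - t ^ n *s (a ^ n *s v))" for n v
  proof (induction n)
    case 0
    show ?case by (simp add: polydeg_zero)
  next
    case (Suc n)
    have "polydeg (Suc n) (\<lambda>t. (a * t + b) *s ((a * t + b) ^ n *s v - t ^ n *s (a ^ n *s v))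
        + t ^ n *s (b *s (a ^ n *s v)))"
      by (intro polydeg_add step Suc polydeg_monom) simp
    also have "(\<lambda>t. (a * t + b) *s ((a * t + b) ^ n *s v - t ^ n *s (a ^ n *s v))
        + t ^ n *s (b *s (a ^ n *s v))) =
      (\<lambda>t. (a * t + b) ^ Suc n *s v - t ^ Suc n *s (a ^ Suc n *s v))"
      by (rule ext) (simp add: algebra_simps)
    finally show ?case .
  qed
  then show "polydeg N (\<lambda>t. (a * t + b) ^ N *s v - t ^ N *s (a ^ N *s v))" .
  obtain w where w: "\<And>t. F t = (\<Sum>i<N. t ^ i *s w i)" using assms by (auto simp: polydeg_def)
  have "polydeg N (\<lambda>t. (a * t + b) ^ i *s v)" if "i < N" for i v
  proof -
    have "polydeg N (\<lambda>t. ((a * t + b) ^ i *s v - t ^ i *s (a ^ i *s v)) + t ^ i *s (a ^ i *s v))"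
      using that by (intro polydeg_add polydeg_monom polydeg_mono[OF lead]) auto
    then show ?thesis by simp
  qed
  then show "polydeg N (\<lambda>t. F (a * t + b))" unfolding w by (intro polydeg_sum) auto
qed

text \<open>Dropping vanishing top coefficients must stop, since the value \<open>F t0\<close> is
  nonzero.\<close>

lemma polydeg_leading:
  assumes "polydeg N F" "F t0 \<noteq> 0"
  shows "\<exists>n v G. v \<noteq> 0 \<and> polydeg n G \<and> (\<forall>t. F t = t ^ n *s v + G t)"
  using assms
proof (induction N)
  case 0
  then show ?case by (simp add: polydeg_def)
next
  case (Suc N)
  then obtain w where w: "\<And>t. F t = (\<Sum>i<Suc N. t ^ i *s w i)" by (auto simp: polydeg_def)
  show ?case
  proof (cases "w N = 0")
    case True
    then have "polydeg N F" unfolding polydeg_def w by auto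
    with Suc show ?thesis by blast
  next
    case False
    have "polydeg N (\<lambda>t. \<Sum>i<N. t ^ i *s w i)" unfolding polydeg_def by blast
    with False w show ?thesis
      by (intro exI[of _ N] exI[of _ "w N"] exI[of _ "\<lambda>t. \<Sum>i<N. t ^ i *s w i"])
        (simp add: add.commute)
  qed
qed

end

section \<open>Limits of subspaces\<close>

context finite_dimensional_vector_space
begin

text \<open>Each coordinate that cuts out \<open>S\<close> is a scalar polynomial in t with
  infinitely many roots, hence zero. Later this passes from invariance under a one-parameter group
  to invariance under its coefficient operators.\<close>

lemma polynomial_curve_coeffs_mem:
  assumes "subspace S" "infinite T" "\<And>t. t \<in> T \<Longrightarrow> (\<Sum>i<N. t ^ i *s w i) \<in> S" "i < N"
  shows "w i \<in> S"
proof -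
  obtain A B where AB: "A \<subseteq> B" "independent B" "span B = UNIV"
    "\<And>v. v \<in> S \<longleftrightarrow> (\<forall>b\<in>B - A. representation B v b = 0)"
    using subspace_adapted_basis[OF assms(1)] by metis
  have "representation B (w i) b = 0" if b: "b \<in> B - A" for b
  proof -
    define p where "p = (\<Sum>i<N. monom (representation B (w i) b) i)"
    have "poly p t = 0" if "t \<in> T" for t
    proof -
      have "poly p t = representation B (\<Sum>i<N. t ^ i *s w i) b"
        unfolding p_def
        by (simp add: poly_sum poly_monom AB representation_sum representation_scale mult.commute)
      also have "\<dots> = 0" using AB(4) assms(3)[OF that] b by blast
      finally show ?thesis .
    qed
    then have "T \<subseteq> {t. poly p t = 0}" by blast
    then have "p = 0" using assms(2) poly_roots_finite infinite_super by blast
    moreover have "coeff p i = representation B (w i) b"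
      unfolding p_def using assms(4) by (simp add: coeff_sum if_distrib cong: if_cong)
    ultimately show ?thesis by simp
  qed
  then show ?thesis using AB(4) by blast
qed

lemma polynomial_curve_leading_coeff_mem:
  assumes "subspace S" "infinite T" "polydeg N F" "\<And>t. t \<in> T \<Longrightarrow> t ^ N *s v + F t \<in> S"
  shows "v \<in> S"
proof -
  obtain w where w: "\<And>t. F t = (\<Sum>i<N. t ^ i *s w i)" using assms(3) by (auto simp: polydeg_def)
  have "(\<Sum>i<Suc N. t ^ i *s (w(N := v)) i) \<in> S" if "t \<in> T" for t
  proof -
    have "(\<Sum>i<N. t ^ i *s (w(N := v)) i) = F t" unfolding w by (rule sum.cong) auto
    then show ?thesis using assms(4)[OF that] by (simp add: add.commute)
  qed
  from polynomial_curve_coeffs_mem[OF assms(1,2) this, of N] show ?thesis by simp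
qed

end

text \<open>The limit for \<open>t \<longrightarrow> \<infinity>\<close> of a family of subspaces, in the Grassmannian:
  all leading coefficients of polynomial sections.\<close>

definition (in vector_space) limit_subspace :: "'a set \<Rightarrow> ('a \<Rightarrow> 'b set) \<Rightarrow> 'b set" where
  "limit_subspace T U = {v. \<exists>N F. polydeg N F \<and> (\<forall>t\<in>T. t ^ N *s v + F t \<in> U t)}"

context vector_space
begin

lemma subspace_limit_subspace:
  assumes "\<And>t. t \<in> T \<Longrightarrow> subspace (U t)"
  shows "subspace (limit_subspace T U)"
proof (rule subspaceI)
  show "0 \<in> limit_subspace T U"
  proof -
    have "polydeg 0 (\<lambda>_. 0) \<and> (\<forall>t\<in>T. t ^ 0 *s 0 + 0 \<in> U t)"
      using assms by (simp add: polydeg_zero subspace_0)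
    then show ?thesis unfolding limit_subspace_def by blast
  qed
next
  fix v v' assume "v \<in> limit_subspace T U" "v' \<in> limit_subspace T U"
  then obtain N F N' F' where F: "polydeg N F" "\<And>t. t \<in> T \<Longrightarrow> t ^ N *s v + F t \<in> U t"
    and F': "polydeg N' F'" "\<And>t. t \<in> T \<Longrightarrow> t ^ N' *s v' + F' t \<in> U t"
    unfolding limit_subspace_def by blast
  \<comment> \<open>Sections of different degrees reach the common degree \<open>N' + N\<close>
    after multiplication by powers of t.\<close>
  let ?G = "\<lambda>t. t ^ N' *s F t + t ^ N *s F' t"
  have "polydeg (N' + N) ?G"
    using polydeg_power_scale[OF F(1), of N'] polydeg_power_scale[OF F'(1), of N]
    by (intro polydeg_add) (simp_all add: add.commute)
  moreover have "t ^ (N' + N) *s (v + v') + ?G t \<in> U t" if "t \<in> T" for t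
  proof -
    have "t ^ N' *s (t ^ N *s v + F t) + t ^ N *s (t ^ N' *s v' + F' t) \<in> U t"
      using F(2)[OF that] F'(2)[OF that] assms[OF that] by (metis subspace_add subspace_scale)
    then show ?thesis by (simp add: algebra_simps power_add)
  qed
  ultimately show "v + v' \<in> limit_subspace T U" unfolding limit_subspace_def by blast
next
  fix c v assume "v \<in> limit_subspace T U"
  then obtain N F where F: "polydeg N F" "\<And>t. t \<in> T \<Longrightarrow> t ^ N *s v + F t \<in> U t"
    unfolding limit_subspace_def by blast
  have "t ^ N *s (c *s v) + c *s F t \<in> U t" if "t \<in> T" for t
    using subspace_scale[OF assms F(2), OF that that, of c] by (simp add: algebra_simps)
  then show "c *s v \<in> limit_subspace T U"
    unfolding limit_subspace_def using polydeg_scale[OF F(1), of c] by blast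
qed

text \<open>\<open>H\<close> carries the member at a t + b into the member at t, and this change of
  parameter fixes t = infinity. A section with leading coefficient \<open>v\<close> becomes one with
  \<open>a ^ N *s H v\<close>, and \<open>a\<close> is invertible.\<close>

lemma limit_subspace_invariant:
  assumes "Vector_Spaces.linear scale scale H" "a \<noteq> 0"
    and sub: "\<And>t. t \<in> T \<Longrightarrow> subspace (U t)"
    and T: "\<And>t. t \<in> T \<Longrightarrow> a * t + b \<in> T"
    and HU: "\<And>t v. t \<in> T \<Longrightarrow> v \<in> U (a * t + b) \<Longrightarrow> H v \<in> U t"
    and "v \<in> limit_subspace T U"
  shows "H v \<in> limit_subspace T U"
proof -
  interpret H: Vector_Spaces.linear scale scale H by fact
  obtain N F where F: "polydeg N F" "\<And>t. t \<in> T \<Longrightarrow> t ^ N *s v + F t \<in> U t"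
    using assms(6) unfolding limit_subspace_def by blast
  let ?G = "\<lambda>t. H (((a * t + b) ^ N *s v - t ^ N *s (a ^ N *s v)) + F (a * t + b))"
  have "polydeg N ?G"
    by (intro polydeg_linear_image[OF assms(1)] polydeg_add polydeg_affine(1)[OF F(1)]
      polydeg_affine(2)[OF F(1)])
  moreover have "t ^ N *s (a ^ N *s H v) + ?G t \<in> U t" if "t \<in> T" for t
    using HU[OF that F(2)[OF T[OF that]]] by (simp add: H.add H.diff H.scale)
  ultimately have "a ^ N *s H v \<in> limit_subspace T U" unfolding limit_subspace_def by blast
  then have "inverse (a ^ N) *s (a ^ N *s H v) \<in> limit_subspace T U"
    using subspace_scale[OF subspace_limit_subspace[of T U]] sub by blast
  then show ?thesis using assms(2) by simp
qed

end

context finite_dimensional_vector_space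
begin

text \<open>If the limit had smaller dimension, then a suitable combination, with coefficients
  polynomial in \<open>t\<close>, of the images of a basis of \<open>P\<close> would have a leading coefficient at which
  all coordinate functions of the limit vanish.\<close>

lemma dim_le_dim_limit_subspace:
  assumes "infinite T" "subspace P"
    and lin: "\<And>t. t \<in> T \<Longrightarrow> Vector_Spaces.linear scale scale (G t)"
    and inj: "\<And>t v. t \<in> T \<Longrightarrow> v \<in> P \<Longrightarrow> G t v = 0 \<Longrightarrow> v = 0"
    and pol: "\<And>v. v \<in> P \<Longrightarrow> \<exists>N. polydeg N (\<lambda>t. G t v)"
  shows "dim P \<le> dim (limit_subspace T (\<lambda>t. G t ` P))"
proof (rule ccontr)
  let ?L = "limit_subspace T (\<lambda>t. G t ` P)"
  assume "\<not> dim P \<le> dim ?L"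
  have subU: "subspace (G t ` P)" if "t \<in> T" for t
  proof -
    interpret Vector_Spaces.linear scale scale "G t" by (rule lin[OF that])
    show ?thesis by (rule subspace_image) fact
  qed
  have "subspace ?L" by (rule subspace_limit_subspace) (rule subU)
  then obtain A B where AB: "A \<subseteq> B" "independent B" "finite B" "span B = UNIV" "span A = ?L"
    "card A = dim ?L" by (rule subspace_adapted_basis)
  obtain J where J: "J \<subseteq> P" "independent J" "P \<subseteq> span J" "card J = dim P"
    using basis_exists by blast
  have finJ: "finite J" using J finiteI_independent by blast
  have finA: "finite A" using AB finite_subset by blast
  have coord: "\<exists>p. \<forall>t. representation B (G t j) a = poly p t" if j: "j \<in> J" for j a
  proof -
    obtain N where "polydeg N (\<lambda>t. G t j)" using j J(1) pol by blast
    then obtain w where w: "\<And>t. G t j = (\<Sum>i<N. t ^ i *s w i)" by (auto simp: polydeg_def)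
    show ?thesis
      by (intro exI[of _ "\<Sum>i<N. monom (representation B (w i) a) i"])
        (simp add: w poly_sum poly_monom AB representation_sum representation_scale mult.commute)
  qed
  define c where "c a j = (SOME p. \<forall>t. representation B (G t j) a = poly p t)" for a j
  have c: "representation B (G t j) a = poly (c a j) t" if "j \<in> J" for a j t
    using someI_ex[OF coord[OF that]] unfolding c_def by blast
  \<comment> \<open>One equation for each basis vector of the limit, one unknown for each of
    \<open>P\<close>; coefficients and unknowns are polynomials in t.\<close>
  obtain r where r: "\<exists>j\<in>J. r j \<noteq> 0" "\<And>a. a \<in> A \<Longrightarrow> (\<Sum>j\<in>J. c a j * r j) = 0"
    using homogeneous_system_nontrivial_solution[OF finA finJ, of c] AB(6) J(4)
      \<open>\<not> dim P \<le> dim ?L\<close> by (metis not_le)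
  define F where "F t = (\<Sum>j\<in>J. poly (r j) t *s G t j)" for t
  have coord0: "representation B (F t) a = 0" if "a \<in> A" for a t
  proof -
    have "representation B (F t) a = (\<Sum>j\<in>J. poly (r j) t * poly (c a j) t)"
      unfolding F_def by (simp add: AB representation_sum representation_scale c)
    also have "\<dots> = poly (\<Sum>j\<in>J. c a j * r j) t" by (simp add: poly_sum mult.commute)
    finally show ?thesis using r(2)[OF that] by simp
  qed
  have Fimg: "F t = G t (\<Sum>j\<in>J. poly (r j) t *s j)" if "t \<in> T" for t
  proof -
    interpret Vector_Spaces.linear scale scale "G t" by (rule lin[OF that])
    show ?thesis unfolding F_def by (simp add: sum scale)
  qed
  have combP: "(\<Sum>j\<in>J. f j *s j) \<in> P" for f
    using J(1) assms(2) by (intro subspace_sum subspace_scale) auto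
  have "\<exists>N. polydeg N F"
    unfolding F_def
  proof (rule polydeg_sum_ex[OF finJ])
    fix j assume "j \<in> J"
    then obtain N where "polydeg N (\<lambda>t. G t j)" using J(1) pol by blast
    from polydeg_poly_scale[OF this] show "\<exists>N. polydeg N (\<lambda>t. poly (r j) t *s G t j)" .
  qed
  then obtain N where N: "polydeg N F" by blast
  \<comment> \<open>Otherwise the leading coefficient of \<open>F\<close> lies in the limit, the
    span of \<open>A\<close>, while its coordinates along \<open>A\<close> vanish like those of
    \<open>F\<close>.\<close>
  have F0: "F t = 0" for t
  proof (rule ccontr)
    assume "F t \<noteq> 0"
    from polydeg_leading[OF N this] obtain n v K where
      v: "v \<noteq> 0" "polydeg n K" "\<And>t. F t = t ^ n *s v + K t" by blast
    have "t ^ n *s v + K t \<in> G t ` P" if "t \<in> T" for t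
      using Fimg[OF that] combP v(3) by auto
    with v(2) have "v \<in> ?L" unfolding limit_subspace_def by blast
    moreover have "representation B v a = 0" if "a \<in> A" for a
    proof -
      have "subspace {u. representation B u a = 0}"
        by (rule subspaceI) (simp_all add: representation_zero AB representation_add representation_scale)
      moreover have "t ^ n *s v + K t \<in> {u. representation B u a = 0}" if "t \<in> T" for t
        using coord0[OF \<open>a \<in> A\<close>, of t] v(3)[of t] by simp
      ultimately have "v \<in> {u. representation B u a = 0}"
        using polynomial_curve_leading_coeff_mem[OF _ assms(1) v(2)] by blast
      then show ?thesis by simp
    qed
    moreover have "representation B v = representation A v"
      using representation_extend[OF AB(2) _ AB(1), of v] AB(5) \<open>v \<in> ?L\<close> by simp
    ultimately have "v = 0"
      using sum_representation_eq[of A v A] finA AB independent_mono[OF AB(2) AB(1)] by simp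
    with v(1) show False by simp
  qed
  \<comment> \<open>Since each \<open>G t\<close> is injective on \<open>P\<close>, the combination
    itself vanishes, and \<open>r j\<close> has the infinite set \<open>T\<close> among its
    roots.\<close>
  have "r j = 0" if "j \<in> J" for j
  proof -
    have "poly (r j) t = 0" if t: "t \<in> T" for t
    proof -
      have "(\<Sum>j\<in>J. poly (r j) t *s j) = 0"
        using inj[OF t combP[of "\<lambda>j. poly (r j) t"]] F0 Fimg[OF t] by metis
      then show ?thesis
        using independentD[OF J(2) finJ order_refl _ \<open>j \<in> J\<close>, of "\<lambda>j. poly (r j) t"] by blast
    qed
    then have "T \<subseteq> {t. poly (r j) t = 0}" by blast
    then show ?thesis using assms(1) poly_roots_finite infinite_super by blast
  qed
  with r(1) show False by blast
qed

end

section \<open>Generalized eigenspaces\<close>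

definition (in vector_space) shift :: "('b \<Rightarrow> 'b) \<Rightarrow> 'a \<Rightarrow> 'b \<Rightarrow> 'b" where
  "shift T l v = T v - l *s v"

definition (in vector_space) gen_eigenspace :: "('b \<Rightarrow> 'b) \<Rightarrow> 'a \<Rightarrow> 'b set" where
  "gen_eigenspace T l = {v. \<exists>k. (shift T l ^^ k) v = 0}"

context vector_space
begin

lemma linearI:
  assumes "\<And>x y. f (x + y) = f x + f y" "\<And>c x. f (c *s x) = c *s f x"
  shows "Vector_Spaces.linear scale scale f"
  using assms vector_space_axioms by (simp add: Vector_Spaces.linear_iff)

lemma linearD:
  assumes "Vector_Spaces.linear scale scale f"
  shows "f (x + y) = f x + f y" "f (c *s x) = c *s f x" "f 0 = 0" "f (x - y) = f x - f y"
    "f (sum g A) = (\<Sum>i\<in>A. f (g i))"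
proof -
  interpret f: Vector_Spaces.linear scale scale f by fact
  show "f (x + y) = f x + f y" "f (c *s x) = c *s f x" "f 0 = 0" "f (x - y) = f x - f y"
    "f (sum g A) = (\<Sum>i\<in>A. f (g i))" by (simp_all add: f.add f.scale f.diff f.sum)
qed

lemma linear_funpow:
  assumes "Vector_Spaces.linear scale scale f"
  shows "Vector_Spaces.linear scale scale (f ^^ k)"
proof (rule linearI)
  show "(f ^^ k) (x + y) = (f ^^ k) x + (f ^^ k) y" for x y
    by (induction k) (simp_all add: linearD[OF assms])
  show "(f ^^ k) (c *s x) = c *s (f ^^ k) x" for c x
    by (induction k) (simp_all add: linearD[OF assms])
qed

lemma linear_eq_on_spanning:
  assumes "Vector_Spaces.linear scale scale f" "Vector_Spaces.linear scale scale g"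
    and "span A = UNIV" "\<And>x. x \<in> A \<Longrightarrow> f x = g x"
  shows "f x = g x"
proof -
  have "subspace {x. f x = g x}"
    by (rule subspaceI) (simp_all add: linearD[OF assms(1)] linearD[OF assms(2)])
  moreover have "A \<subseteq> {x. f x = g x}" using assms(4) by blast
  ultimately have "span A \<subseteq> {x. f x = g x}" by (rule span_minimal[rotated])
  then show ?thesis using assms(3) by blast
qed

lemma linear_shift:
  assumes "Vector_Spaces.linear scale scale T"
  shows "Vector_Spaces.linear scale scale (shift T l)"
  by (rule linearI) (simp_all add: shift_def linearD[OF assms] algebra_simps)

lemma funpow_linear_eq_0_mono:
  assumes "Vector_Spaces.linear scale scale f" "(f ^^ k) v = 0" "k \<le> m"
  shows "(f ^^ m) v = 0"
proof -
  have "(f ^^ m) v = (f ^^ (m - k)) ((f ^^ k) v)"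
    using assms(3) by (metis comp_apply funpow_add le_add_diff_inverse2)
  then show ?thesis using assms(2) linearD(3)[OF linear_funpow[OF assms(1)]] by simp
qed

lemma subspace_gen_eigenspace:
  assumes T: "Vector_Spaces.linear scale scale T"
  shows "subspace (gen_eigenspace T l)"
proof (rule subspaceI)
  note lin = linear_funpow[OF linear_shift[OF T]]
  show "0 \<in> gen_eigenspace T l" unfolding gen_eigenspace_def using linearD(3)[OF lin] by blast
  show "x + y \<in> gen_eigenspace T l" if xy: "x \<in> gen_eigenspace T l" "y \<in> gen_eigenspace T l" for x y
  proof -
    obtain k m where "(shift T l ^^ k) x = 0" "(shift T l ^^ m) y = 0"
      using xy unfolding gen_eigenspace_def by blast
    then have "(shift T l ^^ max k m) x = 0" "(shift T l ^^ max k m) y = 0"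
      using funpow_linear_eq_0_mono[OF linear_shift[OF T]] by (metis max.cobounded1 max.cobounded2)+
    then have "(shift T l ^^ max k m) (x + y) = 0" by (simp add: linearD(1)[OF lin])
    then show ?thesis unfolding gen_eigenspace_def by blast
  qed
  show "c *s x \<in> gen_eigenspace T l" if "x \<in> gen_eigenspace T l" for c x
    using that unfolding gen_eigenspace_def by (auto simp: linearD(2)[OF lin])
qed

lemma gen_eigenspace_invariant:
  assumes T: "Vector_Spaces.linear scale scale T" and H: "Vector_Spaces.linear scale scale H"
    and comm: "\<And>v. H (T v) = T (H v)" and v: "v \<in> gen_eigenspace T l"
  shows "H v \<in> gen_eigenspace T l"
proof -
  have "(shift T l ^^ k) (H w) = H ((shift T l ^^ k) w)" for k w
    by (induction k) (simp_all add: shift_def linearD[OF H] comm)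
  moreover obtain k where "(shift T l ^^ k) v = 0" using v unfolding gen_eigenspace_def by blast
  ultimately have "(shift T l ^^ k) (H v) = 0" by (simp add: linearD(3)[OF H])
  then show ?thesis unfolding gen_eigenspace_def by blast
qed

lemma shift_commute:
  assumes T: "Vector_Spaces.linear scale scale T"
  shows "shift T l (T v) = T (shift T l v)"
  by (simp add: shift_def linearD[OF T])

lemma shift_gen_eigenspace:
  assumes T: "Vector_Spaces.linear scale scale T" and v: "v \<in> gen_eigenspace T m"
  shows "shift T l v \<in> gen_eigenspace T m"
  by (rule gen_eigenspace_invariant[OF T linear_shift[OF T] _ v]) (rule shift_commute[OF T])

text \<open>On an eigenvector for \<open>l\<close> the operator T - m is the nonzero scalar l - m,
  so no power of it kills a nonzero one.\<close>

lemma shift_eq_0_on_gen_eigenspace: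
  assumes T: "Vector_Spaces.linear scale scale T"
    and "v \<in> gen_eigenspace T m" "shift T l v = 0" "l \<noteq> m"
  shows "v = 0"
proof -
  have "(shift T m ^^ k) v = (l - m) ^ k *s v" for k
  proof (induction k)
    case (Suc k)
    have "shift T m v = (l - m) *s v" using assms(3) by (simp add: shift_def algebra_simps)
    then show ?case
      using Suc by (simp add: linearD[OF linear_shift[OF T]] mult.commute)
  qed simp
  then show ?thesis using assms unfolding gen_eigenspace_def by auto
qed

text \<open>A power of T - m kills the component for \<open>m\<close> but is injective on the other
  generalized eigenspaces, so the induction hypothesis applies to the remaining components.\<close>

lemma gen_eigenspaces_independent:
  assumes T: "Vector_Spaces.linear scale scale T"
    and "finite S" "\<And>l. l \<in> S \<Longrightarrow> c l \<in> gen_eigenspace T l" "(\<Sum>l\<in>S. c l) = 0" "l \<in> S"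
  shows "c l = 0"
  using assms(2-5)
proof (induction S arbitrary: c l rule: finite_induct)
  case empty
  then show ?case by simp
next
  case (insert m S c l)
  have linm: "Vector_Spaces.linear scale scale (shift T m ^^ k)" for k
    by (rule linear_funpow[OF linear_shift[OF T]])
  obtain k where k: "(shift T m ^^ k) (c m) = 0"
    using insert.prems(1)[of m] unfolding gen_eigenspace_def by blast
  have geig: "(shift T m ^^ k) v \<in> gen_eigenspace T j" if "v \<in> gen_eigenspace T j" for v j k
    by (induction k) (simp_all add: that shift_gen_eigenspace[OF T])
  have "(shift T m ^^ k) (\<Sum>l\<in>insert m S. c l) = 0"
    by (simp only: insert.prems(2) linearD(3)[OF linm])
  then have sum0: "(\<Sum>l\<in>S. (shift T m ^^ k) (c l)) = 0"
    using insert.hyps k by (simp add: linearD[OF linm])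
  have IH: "(shift T m ^^ k) (c j) = 0" if "j \<in> S" for j
  proof (rule insert.IH[of "\<lambda>l. (shift T m ^^ k) (c l)"])
    show "(shift T m ^^ k) (c l) \<in> gen_eigenspace T l" if "l \<in> S" for l
      using that by (intro geig insert.prems(1)) simp
  qed (fact sum0 that)+
  have cS: "c j = 0" if j: "j \<in> S" for j
  proof -
    have "(shift T m ^^ i) v = 0 \<longrightarrow> v = 0" if "v \<in> gen_eigenspace T j" for i v
    proof (induction i)
      case (Suc i)
      have "m \<noteq> j" using insert.hyps j by blast
      from shift_eq_0_on_gen_eigenspace[OF T geig[OF that] _ this, of i] Suc show ?case by simp
    qed simp
    from this[OF insert.prems(1)] show ?thesis using IH[OF j] j by blast
  qed
  then have "(\<Sum>l\<in>S. c l) = 0" by (intro sum.neutral) blast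
  with insert.prems(2) insert.hyps have "c m = 0" by simp
  with cS insert.prems(3) show ?case by blast
qed

text \<open>On the generalized eigenspace for \<open>m\<close>, T - l is the nonzero scalar m - l
  plus the locally nilpotent T - m. Induction on the exponent that kills \<open>u\<close> inverts it
  inside \<open>M\<close>.\<close>

lemma shift_surj_on_gen_eigenspace:
  assumes T: "Vector_Spaces.linear scale scale T"
    and M: "subspace M" "\<And>v. v \<in> M \<Longrightarrow> T v \<in> M"
    and u: "u \<in> gen_eigenspace T m \<inter> M" and "l \<noteq> m"
  shows "\<exists>w \<in> gen_eigenspace T m \<inter> M. shift T l w = u"
proof -
  have sub: "subspace (gen_eigenspace T m \<inter> M)"
    by (intro subspace_inter subspace_gen_eigenspace T M)
  have "\<exists>w \<in> gen_eigenspace T m \<inter> M. shift T l w = u"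
    if "(shift T m ^^ k) u = 0" "u \<in> M" for k u
    using that
  proof (induction k arbitrary: u)
    case 0
    then show ?case
      using subspace_0[OF sub] linearD(3)[OF linear_shift[OF T]] by (intro bexI[of _ 0]) auto
  next
    case (Suc k)
    have "shift T m u \<in> M"
      unfolding shift_def by (intro subspace_diff M subspace_scale Suc.prems)
    moreover have "(shift T m ^^ k) (shift T m u) = 0"
      using Suc.prems(1) by (simp add: funpow_swap1)
    ultimately obtain w where w: "w \<in> gen_eigenspace T m \<inter> M" "shift T l w = shift T m u"
      using Suc.IH by blast
    have "u \<in> gen_eigenspace T m \<inter> M" using Suc.prems unfolding gen_eigenspace_def by blast
    \<comment> \<open>From (T - l) w = (T - m) u follows (T - l)(u - w) = (T - l) u - (T - m) u = (m
      - l) u.\<close>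
    then have "inverse (m - l) *s (u - w) \<in> gen_eigenspace T m \<inter> M"
      by (rule subspace_scale[OF sub subspace_diff[OF sub _ w(1)]])
    moreover have "shift T l (inverse (m - l) *s (u - w)) = u"
    proof -
      have "shift T l (u - w) = (m - l) *s u"
        using w(2) by (simp add: linearD[OF linear_shift[OF T]]) (simp add: shift_def algebra_simps)
      then show ?thesis using \<open>l \<noteq> m\<close> by (simp add: linearD[OF linear_shift[OF T]])
    qed
    ultimately show ?case by blast
  qed
  then show ?thesis using u unfolding gen_eigenspace_def by blast
qed

end

text \<open>\<open>D f\<close> is the operator \<open>f(T_s)\<close> for the semisimple part \<open>T_s\<close> of \<open>T\<close>.\<close>

definition (in vector_space) functional_calculus ::
  "('b \<Rightarrow> 'b) \<Rightarrow> 'a set \<Rightarrow> (('a \<Rightarrow> 'a) \<Rightarrow> 'b \<Rightarrow> 'b) \<Rightarrow> bool" where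
  "functional_calculus T S D \<longleftrightarrow> finite S \<and> (\<forall>l. l \<notin> S \<longrightarrow> gen_eigenspace T l = {0}) \<and>
    (\<forall>f. Vector_Spaces.linear scale scale (D f)) \<and>
    (\<forall>f l. \<forall>v\<in>gen_eigenspace T l. D f v = f l *s v) \<and>
    span (\<Union>l. gen_eigenspace T l) = UNIV \<and>
    (\<forall>f v. D f v = (\<Sum>l\<in>S. f l *s D (\<lambda>m. if m = l then 1 else 0) v))"

text \<open>The vectors T^i v with i up to the dimension are one too many to be independent. The
  polynomial may depend on \<open>v\<close>, which suffices for the induction on its degree in
  \<open>span_gen_eigenspaces\<close>.\<close>

lemma (in finite_dimensional_vector_space) annihilating_polynomial:
  fixes T :: "'b \<Rightarrow> 'b"
  shows "\<exists>p. p \<noteq> 0 \<and> (\<Sum>i\<le>degree p. coeff p i *s (T ^^ i) v) = 0"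
proof -
  let ?n = "card Basis"
  obtain r where r: "\<exists>i\<in>{..?n}. r i \<noteq> 0"
    "\<And>b. b \<in> Basis \<Longrightarrow> (\<Sum>i\<in>{..?n}. representation Basis ((T ^^ i) v) b * r i) = 0"
    using homogeneous_system_nontrivial_solution[of Basis "{..?n}"
        "\<lambda>b i. representation Basis ((T ^^ i) v) b"] finite_Basis by auto
  define p where "p = (\<Sum>i\<le>?n. monom (r i) i)"
  have coeff_p: "coeff p i = (if i \<le> ?n then r i else 0)" for i
    unfolding p_def by (simp add: coeff_sum if_distrib cong: if_cong)
  have "degree p \<le> ?n" by (rule degree_le) (simp add: coeff_p)
  then have "(\<Sum>i\<le>degree p. coeff p i *s (T ^^ i) v) = (\<Sum>i\<le>?n. coeff p i *s (T ^^ i) v)"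
    by (intro sum.mono_neutral_left) (auto simp: coeff_eq_0)
  also have "\<dots> = (\<Sum>i\<le>?n. r i *s (T ^^ i) v)" by (simp add: coeff_p)
  also have "\<dots> = 0"
  proof -
    let ?u = "\<Sum>i\<le>?n. r i *s (T ^^ i) v"
    have "representation Basis ?u b = 0" for b
    proof (cases "b \<in> Basis")
      case True
      then show ?thesis
        using r(2)[of b] by (simp add: representation_sum representation_scale
            independent_Basis span_Basis mult.commute)
    qed (use representation_ne_zero in blast)
    then show ?thesis
      using sum_representation_eq[of Basis ?u Basis]
      by (simp add: independent_Basis span_Basis finite_Basis)
  qed
  finally have "(\<Sum>i\<le>degree p. coeff p i *s (T ^^ i) v) = 0" .
  moreover have "p \<noteq> 0" using r(1) coeff_p by (metis atMost_iff coeff_0)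
  ultimately show ?thesis by blast
qed

locale alg_closed_char_0_space = finite_dimensional_vector_space scale Basis
  for scale :: "'k::{alg_closed_field, field_char_0} \<Rightarrow> 'a::ab_group_add \<Rightarrow> 'a" (infixr \<open>*s\<close> 75)
    and Basis
begin

text \<open>Induction on the degree of a polynomial p with p(T) v = 0. For a root l of p, (T - l) v
  is killed by a polynomial of smaller degree, so it is in the span; correcting \<open>v\<close> by
  some w in the span puts (T - l)(v - w), and hence v - w, in the generalized eigenspace of
  l.\<close>

lemma span_gen_eigenspaces:
  assumes T: "Vector_Spaces.linear scale scale T"
    and M: "subspace M" "\<And>v. v \<in> M \<Longrightarrow> T v \<in> M" and "v \<in> M"
  shows "v \<in> span (\<Union>l. gen_eigenspace T l \<inter> M)"
proof -
  let ?E = "\<Union>l. gen_eigenspace T l \<inter> M"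
  note lin = linearD[OF linear_shift[OF T]]
  have EM: "span ?E \<subseteq> M" by (rule span_minimal) (use M in auto)
  \<comment> \<open>T - l is onto on the generalized eigenspaces of other eigenvalues; only the
    component for \<open>l\<close> itself is left over.\<close>
  have shift_surj: "\<exists>w\<in>span ?E. u - shift T l w \<in> gen_eigenspace T l \<inter> M" if "u \<in> span ?E" for u l
    using that
  proof (induction rule: span_induct)
    case base
    have sub: "subspace (gen_eigenspace T l \<inter> M)"
      by (intro subspace_inter subspace_gen_eigenspace T M)
    show ?case
    proof (rule subspaceI; unfold mem_Collect_eq)
      show "\<exists>w\<in>span ?E. 0 - shift T l w \<in> gen_eigenspace T l \<inter> M"
        by (rule bexI[of _ 0]) (use subspace_0[OF sub] in \<open>simp_all add: lin span_zero\<close>)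
    next
      fix x y
      assume "\<exists>w\<in>span ?E. x - shift T l w \<in> gen_eigenspace T l \<inter> M"
        "\<exists>w\<in>span ?E. y - shift T l w \<in> gen_eigenspace T l \<inter> M"
      then obtain w w' where w: "w \<in> span ?E" "x - shift T l w \<in> gen_eigenspace T l \<inter> M"
        "w' \<in> span ?E" "y - shift T l w' \<in> gen_eigenspace T l \<inter> M" by blast
      have "x + y - shift T l (w + w') = (x - shift T l w) + (y - shift T l w')" by (simp add: lin)
      then show "\<exists>w\<in>span ?E. x + y - shift T l w \<in> gen_eigenspace T l \<inter> M"
        using span_add[OF w(1,3)] subspace_add[OF sub w(2,4)] by metis
    next
      fix c x
      assume "\<exists>w\<in>span ?E. x - shift T l w \<in> gen_eigenspace T l \<inter> M"
      then obtain w where w: "w \<in> span ?E" "x - shift T l w \<in> gen_eigenspace T l \<inter> M" by blast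
      have "c *s x - shift T l (c *s w) = c *s (x - shift T l w)" by (simp add: lin algebra_simps)
      then show "\<exists>w\<in>span ?E. c *s x - shift T l w \<in> gen_eigenspace T l \<inter> M"
        using span_scale[OF w(1)] subspace_scale[OF sub w(2)] by metis
    qed
  next
    case (step u)
    then obtain m where m: "u \<in> gen_eigenspace T m \<inter> M" by blast
    show ?case
    proof (cases "l = m")
      case True
      with m show ?thesis by (intro bexI[of _ 0]) (simp_all add: lin span_zero)
    next
      case False
      from shift_surj_on_gen_eigenspace[OF T M m False] obtain w where
        w: "w \<in> gen_eigenspace T m \<inter> M" "shift T l w = u" by blast
      have "subspace (gen_eigenspace T l \<inter> M)"
        by (intro subspace_inter subspace_gen_eigenspace T M)
      with w show ?thesis by (intro bexI[of _ w]) (auto intro: span_base dest: subspace_0)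
    qed
  qed
  have "v \<in> span ?E" if "p \<noteq> 0" "(\<Sum>i\<le>degree p. coeff p i *s (T ^^ i) v) = 0" "v \<in> M" for p v
    using that
  proof (induction "degree p" arbitrary: p v)
    case 0
    then have "coeff p 0 \<noteq> 0" by (metis leading_coeff_0_iff)
    with 0 have "v = 0" by simp
    then show ?case by (simp add: span_zero)
  next
    case (Suc n)
    then obtain l where "poly p l = 0" using alg_closed_imp_poly_has_root[of p] by auto
    then obtain q where q: "p = [:-l, 1:] * q" by (metis poly_eq_0_iff_dvd dvdE)
    with Suc.prems have "q \<noteq> 0" by auto
    then have "degree ([:-l, 1:] * q) = degree [:-l, 1:] + degree q" by (intro degree_mult_eq) auto
    then have deg: "degree p = Suc (degree q)" by (simp only: q[symmetric]) simp
    have coeff_p: "coeff p i = (if i = 0 then 0 else coeff q (i - 1)) - l * coeff q i" for i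
      unfolding q by (cases i) simp_all
    \<comment> \<open>The index shift behind p(T) v = q(T) (T - l) v for p = (X - l) q.\<close>
    have "(\<Sum>i\<le>degree p. coeff p i *s (T ^^ i) v)
        = (\<Sum>i\<le>Suc (degree q). (if i = 0 then 0 else coeff q (i - 1)) *s (T ^^ i) v)
          - (\<Sum>i\<le>Suc (degree q). (l * coeff q i) *s (T ^^ i) v)"
      by (simp only: deg coeff_p scale_left_diff_distrib sum_subtractf)
    also have "(\<Sum>i\<le>Suc (degree q). (if i = 0 then 0 else coeff q (i - 1)) *s (T ^^ i) v)
        = (\<Sum>i\<le>degree q. coeff q i *s (T ^^ Suc i) v)"
      by (simp only: sum.atMost_Suc_shift) simp
    also have "(\<Sum>i\<le>Suc (degree q). (l * coeff q i) *s (T ^^ i) v)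
        = (\<Sum>i\<le>degree q. (l * coeff q i) *s (T ^^ i) v)" by (simp add: coeff_eq_0)
    also have "(\<Sum>i\<le>degree q. coeff q i *s (T ^^ Suc i) v) - \<dots>
        = (\<Sum>i\<le>degree q. coeff q i *s (T ^^ i) (shift T l v))"
      by (simp add: shift_def linearD[OF linear_funpow[OF T]] funpow_swap1 sum_subtractf[symmetric]
          scale_right_diff_distrib mult.commute)
    finally have "(\<Sum>i\<le>degree q. coeff q i *s (T ^^ i) (shift T l v)) = 0" using Suc.prems by simp
    moreover have "shift T l v \<in> M"
      unfolding shift_def by (intro subspace_diff M subspace_scale Suc.prems)
    ultimately have "shift T l v \<in> span ?E" using Suc.hyps(1)[of q] Suc.hyps(2) deg \<open>q \<noteq> 0\<close> by simp
    from shift_surj[OF this, of l] obtain w where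
      w: "w \<in> span ?E" "shift T l v - shift T l w \<in> gen_eigenspace T l \<inter> M" by blast
    then obtain k where "(shift T l ^^ k) (shift T l (v - w)) = 0"
      unfolding gen_eigenspace_def by (auto simp: lin)
    then have "(shift T l ^^ Suc k) (v - w) = 0" by (simp add: funpow_swap1)
    then have "v - w \<in> gen_eigenspace T l" unfolding gen_eigenspace_def by blast
    moreover have "v - w \<in> M" using Suc.prems w EM M(1) by (blast intro: subspace_diff)
    ultimately have "v - w \<in> span ?E" by (blast intro: span_base)
    from span_add[OF this w(1)] show ?case by simp
  qed
  with annihilating_polynomial[of T v] \<open>v \<in> M\<close> show ?thesis by blast
qed

lemma ex_functional_calculus:
  assumes T: "Vector_Spaces.linear scale scale T"
  shows "\<exists>S D. functional_calculus T S D"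
proof -
  interpret pair: vector_space_pair scale scale ..
  have span: "span (\<Union>l. gen_eigenspace T l) = UNIV"
    using span_gen_eigenspaces[OF T subspace_UNIV] by auto
  obtain B where B: "B \<subseteq> (\<Union>l. gen_eigenspace T l)" "independent B" "(\<Union>l. gen_eigenspace T l) \<subseteq> span B"
    using maximal_independent_subset by metis
  have spB: "span B = UNIV" using span span_mono[OF B(3)] by (simp add: span_span top.extremum_uniqueI)
  have finB: "finite B" using B finiteI_independent by blast
  obtain lam where lam: "\<And>b. b \<in> B \<Longrightarrow> b \<in> gen_eigenspace T (lam b)" using B(1) by (metis UN_E subsetD)
  \<comment> \<open>\<open>D f\<close> is fixed by its scaling of a basis of generalized
    eigenvectors; \<open>Deig\<close> extends the scaling to whole generalized eigenspaces.\<close>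
  define D where "D f = (SOME g. Vector_Spaces.linear scale scale g \<and> (\<forall>b\<in>B. g b = f (lam b) *s b))" for f
  have D: "Vector_Spaces.linear scale scale (D f) \<and> (\<forall>b\<in>B. D f b = f (lam b) *s b)" for f
    unfolding D_def
    by (rule someI_ex[OF pair.linear_independent_extend[OF B(2), of "\<lambda>b. f (lam b) *s b"]])
  note Dlin = conjunct1[OF D]
  \<comment> \<open>The expansion of \<open>v\<close> could involve basis vectors with other labels.
    Grouped by label, its components are compared with \<open>v\<close> at \<open>l\<close> and 0
    elsewhere, and independence makes them agree.\<close>
  have Deig: "D f v = f l *s v" if v: "v \<in> gen_eigenspace T l" for f l v
  proof -
    define r where "r = representation B v"
    have vB: "v = (\<Sum>b\<in>B. r b *s b)"
      unfolding r_def using sum_representation_eq[OF B(2) _ finB order_refl] spB by simp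
    \<comment> \<open>\<open>l\<close> need not be the label of a basis vector, hence the
      \<open>insert\<close>.\<close>
    define S where "S = insert l (lam ` B)"
    have finS: "finite S" using finB by (simp add: S_def)
    define c where "c m = (\<Sum>b\<in>{b\<in>B. lam b = m}. r b *s b)" for m
    have cm: "c m \<in> gen_eigenspace T m" for m
      unfolding c_def using lam
      by (intro subspace_sum subspace_scale subspace_gen_eigenspace[OF T]) auto
    have vc: "v = (\<Sum>m\<in>S. c m)"
      unfolding c_def vB
      by (subst sum.group[OF finB finS]) (auto simp: S_def)
    have d: "c m - (if m = l then v else 0) = 0" if "m \<in> S" for m
    proof (rule gen_eigenspaces_independent[OF T finS _ _ that])
      show "c m - (if m = l then v else 0) \<in> gen_eigenspace T m" for m
        using cm v subspace_diff[OF subspace_gen_eigenspace[OF T]] by auto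
      show "(\<Sum>m\<in>S. c m - (if m = l then v else 0)) = 0"
        using finS vc by (simp add: sum_subtractf S_def)
    qed
    have Dc: "D f (c m) = f m *s c m" for m
      unfolding c_def using D by (simp add: linearD[OF Dlin] scale_sum_right mult.commute)
    have "D f v = (\<Sum>m\<in>S. f m *s c m)" by (subst vc) (simp add: linearD[OF Dlin] Dc)
    also have "\<dots> = (\<Sum>m\<in>S. if m = l then f l *s v else 0)"
      by (rule sum.cong) (use d in auto)
    also have "\<dots> = f l *s v" using finS by (simp add: S_def)
    finally show ?thesis .
  qed
  have triv: "gen_eigenspace T l = {0}" if "l \<notin> lam ` B" for l
  proof -
    have "v = 0" if v: "v \<in> gen_eigenspace T l" for v
    proof -
      \<comment> \<open>\<open>D\<close> of this indicator kills the whole basis, yet is the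
        identity on the generalized eigenspace of \<open>l\<close>.\<close>
      let ?f = "\<lambda>m. if m = l then 1 else 0"
      have "D ?f v = 0"
        by (rule linear_eq_on_spanning[OF Dlin _ spB, of "\<lambda>_. 0"])
          (use D \<open>l \<notin> lam ` B\<close> in \<open>auto intro: linearI\<close>)
      with Deig[OF v, of ?f] show ?thesis by simp
    qed
    then show ?thesis using subspace_0[OF subspace_gen_eigenspace[OF T]] by blast
  qed
  have sumD: "D f v = (\<Sum>l\<in>lam ` B. f l *s D (\<lambda>m. if m = l then 1 else 0) v)" for f v
  proof (rule linear_eq_on_spanning[OF Dlin _ span])
    show "Vector_Spaces.linear scale scale (\<lambda>v. \<Sum>l\<in>lam ` B. f l *s D (\<lambda>m. if m = l then 1 else 0) v)"
      by (rule linearI) (simp_all add: linearD[OF Dlin] scale_right_distrib sum.distrib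
          scale_sum_right mult.commute)
    fix x assume "x \<in> (\<Union>l. gen_eigenspace T l)"
    then obtain m where m: "x \<in> gen_eigenspace T m" by blast
    have "(\<Sum>l\<in>lam ` B. f l *s D (\<lambda>m. if m = l then 1 else 0) x)
        = (\<Sum>l\<in>lam ` B. if l = m then f m *s x else 0)"
      by (rule sum.cong) (auto simp: Deig[OF m])
    also have "\<dots> = f m *s x" using triv[of m] m finB by auto
    finally show "D f x = (\<Sum>l\<in>lam ` B. f l *s D (\<lambda>m. if m = l then 1 else 0) x)"
      using Deig[OF m] by simp
  qed
  have "functional_calculus T (lam ` B) D"
    unfolding functional_calculus_def using finB triv Dlin Deig span sumD by blast
  then show ?thesis by blast
qed

end

section \<open>Lie algebras: the limit under the semisimple part\<close>

lemma (in vector_space) bilinear_eq_on_spanning: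
  assumes B: "\<And>y. Vector_Spaces.linear scale scale (\<lambda>x. B x y)" "\<And>x. Vector_Spaces.linear scale scale (B x)"
    and B': "\<And>y. Vector_Spaces.linear scale scale (\<lambda>x. B' x y)" "\<And>x. Vector_Spaces.linear scale scale (B' x)"
    and A: "span A = UNIV" "\<And>x y. x \<in> A \<Longrightarrow> y \<in> A \<Longrightarrow> B x y = B' x y"
  shows "B x y = B' x y"
proof (rule linear_eq_on_spanning[OF B(2) B'(2) A(1)])
  fix y assume "y \<in> A"
  then show "B x y = B' x y"
    by (intro linear_eq_on_spanning[OF B(1) B'(1) A(1), of y y x] A(2))
qed

context lie_algebra
begin

lemmas bracket_left = linearD[OF bracket_linear_left]
lemmas bracket_right = linearD[OF bracket_linear_right]

lemma bracket_anticomm: "bracket x y = - bracket y x"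
proof -
  have "0 = bracket (x + y) (x + y)" by (simp only: bracket_self)
  also have "\<dots> = bracket x y + bracket y x"
    by (subst bracket_left(1)) (simp add: bracket_right(1) bracket_self)
  finally have "bracket x y + bracket y x = 0" by simp
  then show ?thesis by (simp add: eq_neg_iff_add_eq_0)
qed

lemma bracket_derivation: "bracket x (bracket a b) = bracket (bracket x a) b + bracket a (bracket x b)"
proof -
  have "bracket b (bracket x a) = - bracket (bracket x a) b" by (rule bracket_anticomm)
  moreover have "bracket a (bracket b x) = - bracket a (bracket x b)"
    using bracket_anticomm[of b x] linearD(4)[OF bracket_linear_right, of a 0] by (simp add: bracket_right(3))
  ultimately have "bracket x (bracket a b) + - bracket a (bracket x b) + - bracket (bracket x a) b = 0"
    using jacobi[of x a b] by (simp only:)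
  then show ?thesis by (simp add: algebra_simps)
qed

text \<open>Leibniz rule: ad x - (l + m) sends [a, b] to [(ad x - l) a, b] + [a, (ad x - m) b], so
  each application lowers the sum i + j of the nilpotency exponents by one.\<close>

lemma bracket_gen_eigenspaces:
  assumes "a \<in> gen_eigenspace (bracket x) l" "b \<in> gen_eigenspace (bracket x) m"
  shows "bracket a b \<in> gen_eigenspace (bracket x) (l + m)"
proof -
  let ?s = "shift (bracket x)"
  note lin = linearD[OF linear_funpow[OF linear_shift[OF bracket_linear_right]]]
  have shift_bracket: "?s (l + m) (bracket a b) = bracket (?s l a) b + bracket a (?s m b)" for a b
    by (simp add: shift_def bracket_derivation[of x a b] bracket_left bracket_right algebra_simps)
  have "(?s (l + m) ^^ n) (bracket a b) = 0"
    if "i + j = n" "(?s l ^^ i) a = 0" "(?s m ^^ j) b = 0" for n i j a b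
    using that
  proof (induction n arbitrary: i j a b)
    case 0
    then show ?case by (simp add: bracket_left)
  next
    case (Suc n)
    show ?case
    proof (cases "i = 0 \<or> j = 0")
      case True
      then have "bracket a b = 0" using Suc.prems by (auto simp: bracket_left bracket_right)
      then show ?thesis by (simp only: lin)
    next
      case False
      then obtain i' j' where ij: "i = Suc i'" "j = Suc j'" by (meson not0_implies_Suc)
      have "(?s (l + m) ^^ n) (bracket (?s l a) b) = 0"
        using Suc.prems ij by (intro Suc.IH[of i' j]) (auto simp: funpow_swap1)
      moreover have "(?s (l + m) ^^ n) (bracket a (?s m b)) = 0"
        using Suc.prems ij by (intro Suc.IH[of i j']) (auto simp: funpow_swap1)
      ultimately have "(?s (l + m) ^^ n) (?s (l + m) (bracket a b)) = 0"
        by (simp only: shift_bracket lin) simp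
      then show ?thesis by (simp add: funpow_swap1)
    qed
  qed
  with assms show ?thesis unfolding gen_eigenspace_def by blast
qed

lemma polydeg_bracket:
  assumes "polydeg N F" "polydeg M G"
  shows "polydeg (N + M) (\<lambda>t. bracket (F t) (G t))"
proof -
  obtain w where w: "\<And>t. F t = (\<Sum>i<N. t ^ i *s w i)" using assms by (auto simp: polydeg_def)
  have "polydeg (N + M) (\<lambda>t. \<Sum>i<N. t ^ i *s bracket (w i) (G t))"
  proof (rule polydeg_sum)
    fix i assume i: "i \<in> {..<N}"
    have "polydeg (i + M) (\<lambda>t. t ^ i *s bracket (w i) (G t))"
      by (rule polydeg_power_scale[OF polydeg_linear_image[OF bracket_linear_right assms(2)]])
    then show "polydeg (N + M) (\<lambda>t. t ^ i *s bracket (w i) (G t))"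
      by (rule polydeg_mono) (use i in simp)
  qed
  then show ?thesis by (simp add: w bracket_left)
qed

end

locale fd_lie_algebra = lie_algebra scale bracket + finite_dimensional_vector_space scale Basis
  for scale :: "'k::field \<Rightarrow> 'a::ab_group_add \<Rightarrow> 'a" (infixr \<open>*s\<close> 75) and bracket Basis
begin

text \<open>The bracket of two sections vanishes on \<open>T\<close>, and [v, v'] is its coefficient
  in degree \<open>N + N'\<close>.\<close>

lemma commutative_limit_subspace:
  assumes "infinite T" "\<And>t. t \<in> T \<Longrightarrow> commutative (U t)"
  shows "commutative (limit_subspace T U)"
  unfolding commutative_def
proof (intro ballI)
  fix v v' assume "v \<in> limit_subspace T U" "v' \<in> limit_subspace T U"
  then obtain N F N' F' where F: "polydeg N F" "\<And>t. t \<in> T \<Longrightarrow> t ^ N *s v + F t \<in> U t"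
    and F': "polydeg N' F'" "\<And>t. t \<in> T \<Longrightarrow> t ^ N' *s v' + F' t \<in> U t"
    unfolding limit_subspace_def by blast
  let ?G = "\<lambda>t. t ^ N *s bracket v (F' t) + t ^ N' *s bracket (F t) v' + bracket (F t) (F' t)"
  have "polydeg (N + N') ?G"
  proof (intro polydeg_add)
    show "polydeg (N + N') (\<lambda>t. t ^ N *s bracket v (F' t))"
      by (intro polydeg_power_scale polydeg_linear_image[OF bracket_linear_right] F')
    show "polydeg (N + N') (\<lambda>t. t ^ N' *s bracket (F t) v')"
      using polydeg_power_scale[OF polydeg_linear_image[OF bracket_linear_left F(1)], of N' v']
      by (simp add: add.commute)
  qed (rule polydeg_bracket[OF F(1) F'(1)])
  moreover have "t ^ (N + N') *s bracket v v' + ?G t \<in> {0}" if "t \<in> T" for t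
  proof -
    have "bracket (t ^ N *s v + F t) (t ^ N' *s v' + F' t) = 0"
      using F(2) F'(2) that assms(2) unfolding commutative_def by blast
    then show ?thesis
      by (simp add: bracket_left bracket_right power_add scale_right_distrib algebra_simps)
  qed
  ultimately show "bracket v v' = 0"
    using polynomial_curve_leading_coeff_mem[OF subspace_single_0 assms(1)] by blast
qed

section \<open>Linear forms and their isotropic subspaces\<close>

lemma dualD:
  assumes "f \<in> dual"
  shows "f (u + v) = f u + f v" "f (c *s v) = c * f v" "f (sum g A) = (\<Sum>i\<in>A. f (g i))" "f 0 = 0"
proof -
  interpret f: Vector_Spaces.linear scale "(*)" f using assms by (simp add: dual_def)
  show "f (u + v) = f u + f v" "f (c *s v) = c * f v" "f (sum g A) = (\<Sum>i\<in>A. f (g i))" "f 0 = 0"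
    by (simp_all add: f.add f.scale f.sum)
qed

lemma subspace_radical: "f \<in> dual \<Longrightarrow> subspace (radical f)"
  unfolding radical_def by (rule subspaceI) (simp_all add: dualD bracket_left)

text \<open>By isotropy the form induces a pairing of P / (P meet L(f)) with L / P, and this has no
  left kernel; so dim P - dim (P meet L(f)) <= dim L - dim P.\<close>

lemma isotropic_dim_le:
  assumes f: "f \<in> dual" and P: "subspace P" and iso: "\<And>u v. u \<in> P \<Longrightarrow> v \<in> P \<Longrightarrow> f (bracket u v) = 0"
  shows "2 * dim P \<le> dim UNIV + dim (radical f)"
proof (rule ccontr)
  assume neg: "\<not> 2 * dim P \<le> dim UNIV + dim (radical f)"
  let ?R = "P \<inter> radical f"
  have subR: "subspace ?R" by (intro subspace_inter P subspace_radical f)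
  obtain A where A: "A \<subseteq> ?R" "independent A" "?R \<subseteq> span A" "card A = dim ?R"
    using basis_exists by blast
  obtain J where J: "A \<subseteq> J" "J \<subseteq> P" "independent J" "P \<subseteq> span J"
    using maximal_independent_subset_extend[of A P] A by blast
  obtain B where B: "J \<subseteq> B" "independent B" "UNIV \<subseteq> span B"
    using maximal_independent_subset_extend[OF subset_UNIV J(3)] by metis
  have fin: "finite B" "finite J" "finite A" using finiteI_independent A J B by blast+
  have "card J = dim P" by (rule basis_card_eq_dim) fact+
  moreover have "card B = dim UNIV" by (rule basis_card_eq_dim[OF subset_UNIV]) fact+
  moreover have "dim ?R \<le> dim (radical f)" by (rule dim_subset) blast
  moreover have "card A \<le> card J" "card J \<le> card B" using fin J B by (auto intro: card_mono)
  \<comment> \<open>\<open>J - A\<close> is a basis of P modulo \<open>?R\<close> and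
    \<open>B - J\<close> one of L modulo P. Orthogonality to \<open>B - J\<close> is enough, since
    \<open>J\<close> lies in the isotropic \<open>P\<close>.\<close>
  ultimately have "card (B - J) < card (J - A)"
    using neg A(4) card_Diff_subset[of J B] card_Diff_subset[of A J] fin J(1) B(1) by linarith
  from homogeneous_system_nontrivial_solution[OF _ _ this, of "\<lambda>y c. f (bracket c y)"] fin
  obtain r where r: "\<exists>c\<in>J - A. r c \<noteq> 0"
    "\<And>y. y \<in> B - J \<Longrightarrow> (\<Sum>c\<in>J - A. f (bracket c y) * r c) = 0" by auto
  define u where "u = (\<Sum>c\<in>J - A. r c *s c)"
  have uP: "u \<in> P" unfolding u_def using J P by (intro subspace_sum subspace_scale) auto
  have "B \<subseteq> {y. f (bracket u y) = 0}"
  proof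
    fix y assume y: "y \<in> B"
    have "f (bracket u y) = (\<Sum>c\<in>J - A. f (bracket c y) * r c)"
      unfolding u_def by (simp add: bracket_left dualD[OF f] mult.commute)
    with r(2)[of y] y iso[OF uP, of y] J(2) show "y \<in> {y. f (bracket u y) = 0}" by auto
  qed
  moreover have "subspace {y. f (bracket u y) = 0}"
    by (rule subspaceI) (simp_all add: bracket_right dualD[OF f])
  ultimately have "span B \<subseteq> {y. f (bracket u y) = 0}" by (rule span_minimal)
  then have "u \<in> radical f" using B(3) unfolding radical_def by blast
  with uP A(3) have "u \<in> span A" by blast
  then have rep: "representation J u = representation A u" by (rule representation_extend[OF J(3) _ J(1)])
  have "r c = 0" if c: "c \<in> J - A" for c
  proof -
    have "representation J (r c' *s c') c = r c' * (if c = c' then 1 else 0)" if "c' \<in> J" for c'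
      using that by (simp add: representation_scale[OF J(3) span_base] representation_basis[OF J(3)])
    then have "representation J u c = (\<Sum>c'\<in>J - A. r c' * (if c = c' then 1 else 0))"
      unfolding u_def by (subst representation_sum[OF J(3)]) (auto intro: span_base span_scale)
    also have "\<dots> = r c" using c fin by (simp add: if_distrib cong: if_cong)
    finally show ?thesis using rep representation_ne_zero[of A u c] c by auto
  qed
  with r(1) show False by blast
qed

end

locale ad_weights = fd_lie_algebra scale bracket Basis + alg_closed_char_0_space scale Basis
  for scale :: "'k::{alg_closed_field, field_char_0} \<Rightarrow> 'a::ab_group_add \<Rightarrow> 'a" (infixr \<open>*s\<close> 75)
    and bracket Basis +
  fixes x :: 'a and S :: "'k set" and D :: "('k \<Rightarrow> 'k) \<Rightarrow> 'a \<Rightarrow> 'a"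
  assumes calculus: "functional_calculus (bracket x) S D"
begin

abbreviation "E \<equiv> gen_eigenspace (bracket x)"

lemma finite_S: "finite S"
  and trivial_outside: "l \<notin> S \<Longrightarrow> E l = {0}"
  and linear_D: "Vector_Spaces.linear scale scale (D f)"
  and D_eig: "v \<in> E l \<Longrightarrow> D f v = f l *s v"
  and span_eig: "span (\<Union>l. E l) = UNIV"
  and D_sum: "D f v = (\<Sum>l\<in>S. f l *s D (\<lambda>m. if m = l then 1 else 0) v)"
  using calculus unfolding functional_calculus_def by blast+

lemma D_comp: "D f (D g v) = D (\<lambda>l. f l * g l) v"
proof (rule linear_eq_on_spanning[OF _ linear_D span_eig])
  show "Vector_Spaces.linear scale scale (\<lambda>v. D f (D g v))"
    by (rule linearI) (simp_all add: linearD[OF linear_D])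
  show "D f (D g v) = D (\<lambda>l. f l * g l) v" if "v \<in> (\<Union>l. E l)" for v
    using that by (auto simp: D_eig linearD[OF linear_D] mult.commute)
qed

lemma D_one: "D (\<lambda>_. 1) v = v"
  by (rule linear_eq_on_spanning[OF linear_D linear_ident span_eig]) (auto simp: D_eig)

lemma span_eig_invariant_subspace:
  assumes "subspace M" "\<And>v. v \<in> M \<Longrightarrow> bracket x v \<in> M" "subspace Q"
    and "\<And>l v. v \<in> E l \<Longrightarrow> v \<in> M \<Longrightarrow> v \<in> Q"
  shows "M \<subseteq> Q"
proof
  fix v assume "v \<in> M"
  then have "v \<in> span (\<Union>l. E l \<inter> M)"
    by (intro span_gen_eigenspaces bracket_linear_right assms(1,2))
  also have "\<dots> \<subseteq> Q" by (rule span_minimal) (use assms(3,4) in auto)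
  finally show "v \<in> Q" .
qed

text \<open>\<open>M\<close> is spanned by the generalized eigenvectors in it, and
  \<open>D f\<close> scales each of them.\<close>

lemma D_invariant_subspace:
  assumes M: "subspace M" "\<And>v. v \<in> M \<Longrightarrow> bracket x v \<in> M" and "v \<in> M"
  shows "D f v \<in> M"
proof -
  have "subspace {v. D f v \<in> M}"
    by (rule subspaceI) (simp_all add: linearD[OF linear_D] subspace_0 subspace_add subspace_scale M(1))
  then have "M \<subseteq> {v. D f v \<in> M}"
    by (intro span_eig_invariant_subspace M) (auto simp: D_eig subspace_scale M(1))
  with assms(3) show ?thesis by blast
qed

text \<open>\<open>G t\<close> is a one-parameter torus and the limit is invariant under it. As
  \<open>e\<close> separates the weights, the weight projections of p are coefficients of
  \<open>G t p\<close> in t, so invariance passes to all \<open>D f\<close>.\<close>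

lemma semisimple_limit:
  assumes P: "subspace P" "commutative P"
    and M: "subspace M" "\<And>v. v \<in> M \<Longrightarrow> bracket x v \<in> M"
    and MP: "\<And>y p. y \<in> M \<Longrightarrow> p \<in> P \<Longrightarrow> bracket y p \<in> P"
  shows "\<exists>P'. subspace P' \<and> commutative P' \<and> dim P \<le> dim P' \<and>
    (\<forall>y\<in>M. \<forall>p\<in>P'. bracket y p \<in> P') \<and> (\<forall>f. \<forall>p\<in>P'. D f p \<in> P')"
proof -
  obtain e :: "'k \<Rightarrow> nat" and c where e: "inj_on e S"
    "\<And>l m. l \<in> S \<Longrightarrow> m \<in> S \<Longrightarrow> l + m \<in> S \<Longrightarrow> e l + e m = c + e (l + m)"
    using separating_nat_weights[OF finite_S] by blast
  define G where "G t = D (\<lambda>l. t ^ e l)" for t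
  \<comment> \<open>At t = 0 the operator \<open>G t\<close> need not be injective.\<close>
  let ?T = "- {0} :: 'k set"
  let ?P = "limit_subspace ?T (\<lambda>t. G t ` P)"
  have linG: "Vector_Spaces.linear scale scale (G t)" for t unfolding G_def by (rule linear_D)
  have G_eig: "G t v = t ^ e l *s v" if "v \<in> E l" for t v l unfolding G_def by (rule D_eig[OF that])
  have infT: "infinite ?T" using infinite_UNIV_char_0[where 'a='k] by (simp add: Compl_eq_Diff_UNIV)
  have G_sum: "G t v = (\<Sum>l\<in>S. t ^ e l *s D (\<lambda>m. if m = l then 1 else 0) v)" for t v
    unfolding G_def by (rule D_sum)
  have G_mult: "G s (G t v) = G (s * t) v" for s t v
    unfolding G_def by (simp add: D_comp power_mult_distrib)
  have G_one: "G 1 v = v" for v unfolding G_def by (simp add: D_one)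
  have G_bracket: "bracket (G t a) (G t b) = t ^ c *s G t (bracket a b)" for t a b
  proof (rule bilinear_eq_on_spanning[where B = "\<lambda>a b. bracket (G t a) (G t b)"
        and B' = "\<lambda>a b. t ^ c *s G t (bracket a b)", OF _ _ _ _ span_eig])
    fix a b assume "a \<in> (\<Union>l. E l)" "b \<in> (\<Union>l. E l)"
    then obtain l m where ab: "a \<in> E l" "b \<in> E m" by blast
    note abE = bracket_gen_eigenspaces[OF ab]
    show "bracket (G t a) (G t b) = t ^ c *s G t (bracket a b)"
    \<comment> \<open>The law for \<open>e\<close> holds only where \<open>l\<close>,
      \<open>m\<close> and \<open>l + m\<close> are all in \<open>S\<close>, which nonzero
      \<open>a\<close>, \<open>b\<close> and bracket guarantee.\<close>
    proof (cases "a = 0 \<or> b = 0 \<or> bracket a b = 0")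
      case True
      then show ?thesis
        by (auto simp: G_eig[OF ab(1)] G_eig[OF ab(2)] bracket_left bracket_right linearD(3)[OF linG])
    next
      case False
      then have "l \<in> S" "m \<in> S" "l + m \<in> S" using trivial_outside ab abE by blast+
      from e(2)[OF this] show ?thesis
        by (simp add: G_eig[OF ab(1)] G_eig[OF ab(2)] G_eig[OF abE] bracket_left bracket_right
            power_add[symmetric] add.commute)
    qed
  next
    show "Vector_Spaces.linear scale scale (\<lambda>a. bracket (G t a) (G t b))"
      "Vector_Spaces.linear scale scale (\<lambda>b. bracket (G t a) (G t b))" for a b
      by (auto intro!: linearI simp: linearD(1,2)[OF linG] bracket_left(1,2) bracket_right(1,2))
    show "Vector_Spaces.linear scale scale (\<lambda>a. t ^ c *s G t (bracket a b))"
      "Vector_Spaces.linear scale scale (\<lambda>b. t ^ c *s G t (bracket a b))" for a b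
      by (auto intro!: linearI simp: linearD(1,2)[OF linG] bracket_left(1,2) bracket_right(1,2)
        scale_right_distrib mult.commute)
  qed
  have subU: "subspace (G t ` P)" for t
  proof -
    interpret G: Vector_Spaces.linear scale scale "G t" by (rule linG)
    show ?thesis by (rule G.subspace_image[OF P(1)])
  qed
  have sub: "subspace ?P" by (rule subspace_limit_subspace[OF subU])
  have comm: "commutative ?P"
    by (rule commutative_limit_subspace[OF infT])
      (use P(2) in \<open>auto simp: commutative_def G_bracket linearD(3)[OF linG]\<close>)
  have dim: "dim P \<le> dim ?P"
  proof (rule dim_le_dim_limit_subspace[OF infT P(1) linG])
    fix t v assume "t \<in> ?T" "G t v = 0"
    then show "v = 0" using G_mult[of "inverse t" t v] by (simp add: G_one linearD(3)[OF linG])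
  next
    fix v
    have "polydeg (Suc (\<Sum>l\<in>S. e l)) (\<lambda>t. \<Sum>l\<in>S. t ^ e l *s D (\<lambda>m. if m = l then 1 else 0) v)"
      by (intro polydeg_sum polydeg_monom)
        (use member_le_sum[of _ S e] finite_S in \<open>simp add: le_imp_less_Suc\<close>)
    then show "\<exists>N. polydeg N (\<lambda>t. G t v)" unfolding G_sum by blast
  qed
  have MP': "bracket y p \<in> ?P" if "y \<in> M" "p \<in> ?P" for y p
  proof -
    have "subspace {y. bracket y p \<in> ?P}"
      by (rule subspaceI) (simp_all add: bracket_left subspace_0 subspace_add subspace_scale sub)
    then have "M \<subseteq> {y. bracket y p \<in> ?P}"
    proof (intro span_eig_invariant_subspace M)
      fix l y assume y: "y \<in> E l" "y \<in> M"
      \<comment> \<open>For a weight vector \<open>y\<close>, ad y commutes with \<open>G t\<close>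
        up to a nonzero scalar, so every member of the family is already invariant.\<close>
      have "bracket y p \<in> ?P"
      proof (rule limit_subspace_invariant[OF bracket_linear_right _ subU, of 1 _ 0])
        fix t v assume t: "t \<in> ?T" and "v \<in> G (1 * t + 0) ` P"
        then obtain q where q: "q \<in> P" "v = G t q" by auto
        have "t ^ e l *s bracket y v = t ^ c *s G t (bracket y q)"
          using G_bracket[of t y q] by (simp add: G_eig[OF y(1)] q bracket_left)
        then have "inverse (t ^ e l) *s (t ^ e l *s bracket y v)
            = inverse (t ^ e l) *s (t ^ c *s G t (bracket y q))" by simp
        then have "bracket y v = (inverse (t ^ e l) * t ^ c) *s G t (bracket y q)" using t by simp
        then show "bracket y v \<in> G t ` P"
          using subspace_scale[OF subU] MP[OF y(2) q(1)] by (metis imageI)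
      qed (use that in auto)
      then show "y \<in> {y. bracket y p \<in> ?P}" by simp
    qed
    with that show ?thesis by blast
  qed
  \<comment> \<open>\<open>G s\<close> maps the member at t / s to the member at t: the torus only
    moves along the family.\<close>
  have GP': "G s p \<in> ?P" if "s \<in> ?T" "p \<in> ?P" for s p
  proof (rule limit_subspace_invariant[OF linG _ subU, of "inverse s" _ 0])
    fix t v assume "v \<in> G (inverse s * t + 0) ` P"
    then obtain q where q: "q \<in> P" "v = G (inverse s * t + 0) q" by blast
    have "s * (inverse s * t + 0) = t" using \<open>s \<in> ?T\<close> by simp
    then have "G s v = G t q" unfolding q(2) G_mult by (rule arg_cong)
    with q(1) show "G s v \<in> G t ` P" by blast
  qed (use that in auto)
  have proj: "D (\<lambda>m. if m = l then 1 else 0) p \<in> ?P" if l: "l \<in> S" and p: "p \<in> ?P" for l p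
  proof -
    let ?N = "Suc (\<Sum>l\<in>S. e l)"
    \<comment> \<open>The coefficient of t^i in \<open>G t p\<close>; since \<open>e\<close> is
      injective, it is a single projection when i is \<open>e l\<close>.\<close>
    define w where "w i = (\<Sum>l\<in>{l\<in>S. e l = i}. D (\<lambda>m. if m = l then 1 else 0) p)" for i
    have lt: "e l < ?N" if "l \<in> S" for l
      using member_le_sum[of l S e] finite_S that by (simp add: le_imp_less_Suc)
    have comb: "(\<Sum>i<?N. t ^ i *s w i) = G t p" for t
    proof -
      have "(\<Sum>i<?N. t ^ i *s w i)
          = (\<Sum>i<?N. \<Sum>l\<in>{l\<in>S. e l = i}. t ^ e l *s D (\<lambda>m. if m = l then 1 else 0) p)"
        unfolding w_def scale_sum_right by (intro sum.cong) auto
      also have "\<dots> = G t p"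
        unfolding G_sum by (rule sum.group[OF finite_S]) (use lt in auto)
      finally show ?thesis .
    qed
    have "w (e l) \<in> ?P"
      by (rule polynomial_curve_coeffs_mem[OF sub infT _ lt[OF l], of w])
        (unfold comb, rule GP'[OF _ p])
    moreover have "{m \<in> S. e m = e l} = {l}" using e(1) l by (auto simp: inj_on_def)
    ultimately show ?thesis by (simp add: w_def)
  qed
  have "D f p \<in> ?P" if "p \<in> ?P" for f p
    by (subst D_sum) (intro subspace_sum subspace_scale sub proj that)
  with sub comm dim MP' show ?thesis by blast
qed

end

section \<open>The limit under the nilpotent part\<close>

text \<open>Cauchy product of two truncated exponentials: a nonzero term has both indices below
  \<open>K\<close>, so its total degree is below \<open>2 * K\<close>.\<close>

lemma truncated_product_sum:
  fixes h :: "nat \<Rightarrow> nat \<Rightarrow> 'a::comm_monoid_add"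
  assumes "\<And>i j. K \<le> i \<or> K \<le> j \<Longrightarrow> h i j = 0"
  shows "(\<Sum>i<K. \<Sum>j<K. h i j) = (\<Sum>k<2 * K. \<Sum>i\<le>k. h i (k - i))"
proof -
  have nz: "i < K \<and> j < K" if "h i j \<noteq> 0" for i j
    using assms that by (meson not_le)
  have fin: "finite {(i, j). i + j < 2 * K}"
    by (rule finite_subset[of _ "{..<2 * K} \<times> {..<2 * K}"]) auto
  have "(\<Sum>i<K. \<Sum>j<K. h i j) = (\<Sum>(i, j)\<in>{..<K} \<times> {..<K}. h i j)"
    by (rule sum.cartesian_product)
  also have "\<dots> = (\<Sum>(i, j)\<in>{(i, j). i + j < 2 * K}. h i j)"
    by (rule sum.mono_neutral_left[OF fin]) (auto dest: nz)
  also have "\<dots> = (\<Sum>k<2 * K. \<Sum>i\<le>k. h i (k - i))" by (rule sum.triangle_reindex)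
  finally show ?thesis .
qed

context ad_weights
begin

definition nil_part :: "'a \<Rightarrow> 'a" where
  "nil_part v = bracket x v - D (\<lambda>l. l) v"

text \<open>Divided powers of the nilpotent part n, the coefficients of exp(t n). With the factorial
  absorbed, the Leibniz rule carries no binomial coefficients.\<close>

definition div_pow :: "nat \<Rightarrow> 'a \<Rightarrow> 'a" where
  "div_pow k v = inverse (fact k) *s (nil_part ^^ k) v"

lemma linear_nil_part: "Vector_Spaces.linear scale scale nil_part"
  by (rule linearI)
    (simp_all add: nil_part_def bracket_right linearD[OF linear_D] scale_right_diff_distrib)

lemma linear_div_pow: "Vector_Spaces.linear scale scale (div_pow k)"
  by (rule linearI)
    (simp_all add: div_pow_def linearD[OF linear_funpow[OF linear_nil_part]]
      scale_right_distrib mult.commute)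

lemma nil_part_eig: "v \<in> E l \<Longrightarrow> nil_part v = shift (bracket x) l v"
  by (simp add: nil_part_def shift_def D_eig)

lemma nil_part_in_eig: "v \<in> E l \<Longrightarrow> nil_part v \<in> E l"
  by (simp add: nil_part_eig shift_gen_eigenspace[OF bracket_linear_right])

lemma nil_part_D: "nil_part (D f v) = D f (nil_part v)"
proof (rule linear_eq_on_spanning[where f = "\<lambda>v. nil_part (D f v)", OF _ _ span_eig])
  show "Vector_Spaces.linear scale scale (\<lambda>v. nil_part (D f v))"
    "Vector_Spaces.linear scale scale (\<lambda>v. D f (nil_part v))"
    by (rule linearI; simp add: linearD[OF linear_D] linearD[OF linear_nil_part])+
  fix v assume "v \<in> (\<Union>l. E l)"
  then obtain l where "v \<in> E l" by blast
  then show "nil_part (D f v) = D f (nil_part v)"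
    by (simp add: D_eig[of _ l] nil_part_in_eig linearD[OF linear_nil_part])
qed

text \<open>On the generalized eigenspace of l the operator is ad x - l, which kills each vector
  after finitely many steps; the exponents of a finite basis are added up to a common one.\<close>

lemma nil_part_nilpotent: "\<exists>K. \<forall>v. (nil_part ^^ K) v = 0"
proof -
  have 1: "\<exists>k. (nil_part ^^ k) v = 0" if v: "v \<in> E l" for v l
  proof -
    have "(shift (bracket x) l ^^ k) v \<in> E l" for k
      by (induction k) (simp_all add: v shift_gen_eigenspace[OF bracket_linear_right])
    then have "(nil_part ^^ k) v = (shift (bracket x) l ^^ k) v" for k
      by (induction k) (simp_all add: nil_part_eig)
    with v show ?thesis unfolding gen_eigenspace_def by auto
  qed
  obtain B where B: "B \<subseteq> (\<Union>l. E l)" "independent B" "(\<Union>l. E l) \<subseteq> span B"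
    using maximal_independent_subset by metis
  have spB: "span B = UNIV" using span_eig span_mono[OF B(3)] by (simp add: span_span top.extremum_uniqueI)
  have finB: "finite B" using B finiteI_independent by blast
  have "\<forall>b\<in>B. \<exists>k. (nil_part ^^ k) b = 0" using 1 B(1) by blast
  then obtain k where k: "\<And>b. b \<in> B \<Longrightarrow> (nil_part ^^ k b) b = 0" by metis
  have "(nil_part ^^ (\<Sum>b\<in>B. k b)) v = 0" for v
  proof (rule linear_eq_on_spanning[OF linear_funpow[OF linear_nil_part] _ spB])
    show "Vector_Spaces.linear scale scale (\<lambda>_. 0)" by (rule linearI) simp_all
    show "(nil_part ^^ (\<Sum>b\<in>B. k b)) b = 0" if "b \<in> B" for b
      by (rule funpow_linear_eq_0_mono[OF linear_nil_part k[OF that]])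
        (rule member_le_sum, use that finB in auto)
  qed
  then show ?thesis by blast
qed

text \<open>ad x is a derivation, and so is its semisimple part, because eigenvalues add under the
  bracket of generalized eigenvectors.\<close>

lemma nil_part_bracket: "nil_part (bracket a b) = bracket (nil_part a) b + bracket a (nil_part b)"
proof -
  have "D (\<lambda>l. l) (bracket a b) = bracket (D (\<lambda>l. l) a) b + bracket a (D (\<lambda>l. l) b)"
  proof (rule bilinear_eq_on_spanning[where B = "\<lambda>a b. D (\<lambda>l. l) (bracket a b)"
        and B' = "\<lambda>a b. bracket (D (\<lambda>l. l) a) b + bracket a (D (\<lambda>l. l) b)", OF _ _ _ _ span_eig])
    fix a b assume "a \<in> (\<Union>l. E l)" "b \<in> (\<Union>l. E l)"
    then obtain l m where ab: "a \<in> E l" "b \<in> E m" by blast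
    show "D (\<lambda>l. l) (bracket a b) = bracket (D (\<lambda>l. l) a) b + bracket a (D (\<lambda>l. l) b)"
      by (simp add: D_eig[OF ab(1)] D_eig[OF ab(2)] D_eig[OF bracket_gen_eigenspaces[OF ab]]
          bracket_left(2) bracket_right(2) scale_left_distrib)
  next
    show "Vector_Spaces.linear scale scale (\<lambda>a. D (\<lambda>l. l) (bracket a b))"
      "Vector_Spaces.linear scale scale (\<lambda>b. D (\<lambda>l. l) (bracket a b))" for a b
      by (auto intro!: linearI simp: linearD(1,2)[OF linear_D] bracket_left(1,2) bracket_right(1,2))
    show "Vector_Spaces.linear scale scale (\<lambda>a. bracket (D (\<lambda>l. l) a) b + bracket a (D (\<lambda>l. l) b))"
      "Vector_Spaces.linear scale scale (\<lambda>b. bracket (D (\<lambda>l. l) a) b + bracket a (D (\<lambda>l. l) b))" for a b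
      by (auto intro!: linearI simp: linearD(1,2)[OF linear_D] bracket_left(1,2) bracket_right(1,2)
          scale_right_distrib)
  qed
  then show ?thesis
    by (simp add: nil_part_def bracket_derivation[of x a b] bracket_left(4) bracket_right(4))
qed

lemma nil_part_div_pow: "nil_part (div_pow k v) = of_nat (Suc k) *s div_pow (Suc k) v"
proof -
  have "inverse (fact k) = (of_nat (Suc k) * inverse (fact (Suc k)) :: 'k)"
    by (simp add: field_simps del: of_nat_Suc)
  then show ?thesis
    by (simp add: div_pow_def linearD[OF linear_nil_part] del: of_nat_Suc fact_Suc)
qed

text \<open>Makes exp(t n) an automorphism. In the induction the terms get the coefficients i and k
  + 1 - i, whose sum k + 1 cancels in characteristic zero.\<close>

lemma div_pow_bracket: "div_pow k (bracket a b) = (\<Sum>i\<le>k. bracket (div_pow i a) (div_pow (k - i) b))"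
proof (induction k)
  case 0
  then show ?case by (simp add: div_pow_def)
next
  case (Suc k)
  let ?g = "\<lambda>i. bracket (div_pow i a) (div_pow (Suc k - i) b)"
  have "of_nat (Suc k) *s div_pow (Suc k) (bracket a b)
      = (\<Sum>i\<le>k. nil_part (bracket (div_pow i a) (div_pow (k - i) b)))"
    by (simp only: nil_part_div_pow[symmetric] Suc linearD[OF linear_nil_part])
  also have "\<dots> = (\<Sum>i\<le>k. of_nat (Suc i) *s ?g (Suc i)) + (\<Sum>i\<le>k. of_nat (Suc k - i) *s ?g i)"
    unfolding sum.distrib[symmetric]
    by (rule sum.cong)
      (auto simp: nil_part_bracket nil_part_div_pow bracket_left(2) bracket_right(2) Suc_diff_le
        simp del: of_nat_Suc)
  also have "(\<Sum>i\<le>k. of_nat (Suc i) *s ?g (Suc i)) = (\<Sum>i\<le>Suc k. of_nat i *s ?g i)"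
    by (simp add: sum.atMost_Suc_shift del: sum.atMost_Suc)
  also have "(\<Sum>i\<le>k. of_nat (Suc k - i) *s ?g i) = (\<Sum>i\<le>Suc k. of_nat (Suc k - i) *s ?g i)"
    by simp
  also have "(\<Sum>i\<le>Suc k. of_nat i *s ?g i) + (\<Sum>i\<le>Suc k. of_nat (Suc k - i) *s ?g i)
      = (\<Sum>i\<le>Suc k. of_nat (Suc k) *s ?g i)"
    unfolding sum.distrib[symmetric] scale_left_distrib[symmetric] of_nat_add[symmetric]
    by (rule sum.cong) auto
  finally have "of_nat (Suc k) *s div_pow (Suc k) (bracket a b) = of_nat (Suc k) *s (\<Sum>i\<le>Suc k. ?g i)"
    by (simp only: scale_sum_right)
  then show ?case by (simp only: scale_cancel_left of_nat_eq_0_iff) simp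
qed

lemma div_pow_div_pow: "div_pow i (div_pow j v) = of_nat ((i + j) choose i) *s div_pow (i + j) v"
proof -
  have "of_nat ((i + j) choose i) * inverse (fact (i + j)) = inverse (fact i) * (inverse (fact j) :: 'k)"
    by (simp add: binomial_fact field_simps)
  then show ?thesis
    by (simp add: div_pow_def linearD[OF linear_funpow[OF linear_nil_part]] funpow_add)
qed

text \<open>The limit of exp(t n) P is invariant under every exp(s n), and n p is the coefficient of
  s in exp(s n) p. Invariance under the semisimple part survives because n commutes with it, so ad
  x, the sum of both, preserves the limit.\<close>

lemma nilpotent_limit:
  assumes P: "subspace P" "commutative P"
    and M: "subspace M" "\<And>v. v \<in> M \<Longrightarrow> bracket x v \<in> M"
    and MP: "\<And>y p. y \<in> M \<Longrightarrow> p \<in> P \<Longrightarrow> bracket y p \<in> P"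
    and DP: "\<And>f p. p \<in> P \<Longrightarrow> D f p \<in> P"
  shows "\<exists>P'. subspace P' \<and> commutative P' \<and> dim P \<le> dim P' \<and>
    (\<forall>y\<in>M. \<forall>p\<in>P'. bracket y p \<in> P') \<and> (\<forall>p\<in>P'. bracket x p \<in> P')"
proof -
  obtain K0 where K0: "\<And>v. (nil_part ^^ K0) v = 0" using nil_part_nilpotent by blast
  \<comment> \<open>The extra 2 keeps the terms of index 0 and 1: index 0 for \<open>G_0\<close>,
    index 1 for reading off \<open>nil_part\<close>.\<close>
  define K where "K = K0 + 2"
  have div_pow_0: "div_pow i v = 0" if "K \<le> i" for i v
    using funpow_linear_eq_0_mono[OF linear_nil_part K0[of v], of i] that
    by (simp add: div_pow_def K_def)
  define G where "G t v = (\<Sum>i<K. t ^ i *s div_pow i v)" for t v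
  let ?P = "limit_subspace UNIV (\<lambda>t. G t ` P)"
  have G_2K: "G t v = (\<Sum>i<2 * K. t ^ i *s div_pow i v)" for t v
    unfolding G_def by (rule sum.mono_neutral_left) (auto simp: div_pow_0)
  have linG: "Vector_Spaces.linear scale scale (G t)" for t
    by (rule linearI) (simp_all add: G_def linearD[OF linear_div_pow] scale_right_distrib
        sum.distrib scale_sum_right mult.commute)
  have G_add: "G s (G t v) = G (s + t) v" for s t v
  proof -
    have "G s (G t v) = (\<Sum>i<K. \<Sum>j<K. (s ^ i * t ^ j) *s div_pow i (div_pow j v))"
      unfolding G_def by (simp add: linearD[OF linear_div_pow] scale_sum_right)
    also have "\<dots> = (\<Sum>k<2 * K. \<Sum>i\<le>k. (s ^ i * t ^ (k - i)) *s div_pow i (div_pow (k - i) v))"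
      by (rule truncated_product_sum) (auto simp: div_pow_0 linearD[OF linear_div_pow])
    also have "\<dots> = (\<Sum>k<2 * K. (s + t) ^ k *s div_pow k v)"
    proof (rule sum.cong)
      fix k
      have "(\<Sum>i\<le>k. (s ^ i * t ^ (k - i)) *s div_pow i (div_pow (k - i) v))
          = (\<Sum>i\<le>k. (of_nat (k choose i) * s ^ i * t ^ (k - i)) *s div_pow k v)"
        by (rule sum.cong) (simp_all add: div_pow_div_pow mult_ac)
      then show "(\<Sum>i\<le>k. (s ^ i * t ^ (k - i)) *s div_pow i (div_pow (k - i) v))
          = (s + t) ^ k *s div_pow k v"
        by (simp only: scale_sum_left[symmetric] binomial_ring)
    qed simp
    finally show ?thesis by (simp add: G_2K)
  qed
  have G_0: "G 0 v = v" for v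
    unfolding G_def K_def by (simp add: sum.lessThan_Suc_shift div_pow_def del: sum.lessThan_Suc)
  have G_bracket: "bracket (G t a) (G t b) = G t (bracket a b)" for t a b
  proof -
    have "bracket (G t a) (G t b)
        = (\<Sum>j<K. \<Sum>i<K. (t ^ i * t ^ j) *s bracket (div_pow i a) (div_pow j b))"
      unfolding G_def by (simp add: bracket_left bracket_right scale_sum_right mult.commute)
    also have "\<dots> = (\<Sum>i<K. \<Sum>j<K. (t ^ i * t ^ j) *s bracket (div_pow i a) (div_pow j b))"
      by (rule sum.swap)
    also have "\<dots> = (\<Sum>k<2 * K. \<Sum>i\<le>k. (t ^ i * t ^ (k - i)) *s bracket (div_pow i a) (div_pow (k - i) b))"
      by (rule truncated_product_sum) (auto simp: div_pow_0 bracket_left bracket_right)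
    also have "\<dots> = G t (bracket a b)"
      unfolding G_2K div_pow_bracket scale_sum_right
      by (intro sum.cong) (auto simp: power_add[symmetric])
    finally show ?thesis .
  qed
  have infT: "infinite (UNIV :: 'k set)" by (rule infinite_UNIV_char_0)
  have subU: "subspace (G t ` P)" for t
  proof -
    interpret G: Vector_Spaces.linear scale scale "G t" by (rule linG)
    show ?thesis by (rule G.subspace_image[OF P(1)])
  qed
  have sub: "subspace ?P" by (rule subspace_limit_subspace[OF subU])
  have comm: "commutative ?P"
    by (rule commutative_limit_subspace[OF infT])
      (use P(2) in \<open>auto simp: commutative_def G_bracket linearD(3)[OF linG]\<close>)
  have dim: "dim P \<le> dim ?P"
  proof (rule dim_le_dim_limit_subspace[OF infT P(1) linG])
    fix t v assume "G t v = 0"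
    then show "v = 0" using G_add[of "- t" t v] by (simp add: G_0 linearD(3)[OF linG])
  next
    show "\<exists>N. polydeg N (\<lambda>t. G t v)" for v
      unfolding polydeg_def G_def by (intro exI[of _ K] exI[of _ "\<lambda>i. div_pow i v"] allI refl)
  qed
  have nilM: "nil_part v \<in> M" if "v \<in> M" for v
    unfolding nil_part_def using M that D_invariant_subspace[OF M that] by (intro subspace_diff) auto
  have "(nil_part ^^ i) v \<in> M" if "v \<in> M" for v i
    by (induction i) (simp_all add: that nilM)
  then have GM: "G t v \<in> M" if "v \<in> M" for v t
    unfolding G_def div_pow_def using that by (intro subspace_sum subspace_scale M(1)) auto
  have MP': "bracket y p \<in> ?P" if y: "y \<in> M" and p: "p \<in> ?P" for y p
  proof (rule limit_subspace_invariant[OF bracket_linear_right _ subU, of 1 _ 0])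
    fix t v assume "v \<in> G (1 * t + 0) ` P"
    then obtain q where q: "q \<in> P" "v = G t q" by auto
    \<comment> \<open>Conjugation by exp(t n) replaces y by exp(-t n) y, which stays in
      \<open>M\<close>.\<close>
    have "bracket y v = G t (bracket (G (- t) y) q)"
      using G_bracket[of t "G (- t) y" q] by (simp add: G_add G_0 q)
    then show "bracket y v \<in> G t ` P" using MP[OF GM[OF y] q(1)] by blast
  qed (use p in auto)
  have DP': "D f p \<in> ?P" if p: "p \<in> ?P" for f p
  proof (rule limit_subspace_invariant[OF linear_D _ subU, of 1 _ 0])
    fix t v assume "v \<in> G (1 * t + 0) ` P"
    then obtain q where q: "q \<in> P" "v = G t q" by auto
    have "(nil_part ^^ i) (D f v) = D f ((nil_part ^^ i) v)" for i v
      by (induction i) (simp_all add: nil_part_D)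
    then have "D f v = G t (D f q)"
      by (simp add: q G_def div_pow_def linearD[OF linear_D])
    then show "D f v \<in> G t ` P" using DP[OF q(1)] by blast
  qed (use p in auto)
  \<comment> \<open>\<open>G s\<close> maps the member at t - s to the member at t.\<close>
  have GP': "G s p \<in> ?P" if p: "p \<in> ?P" for s p
  proof (rule limit_subspace_invariant[OF linG _ subU, of 1 _ "- s"])
    fix t v assume "v \<in> G (1 * t + - s) ` P"
    then show "G s v \<in> G t ` P" by (auto simp: G_add)
  qed (use p in auto)
  have "div_pow 1 p \<in> ?P" if "p \<in> ?P" for p
    by (rule polynomial_curve_coeffs_mem[where N = K and w = "\<lambda>i. div_pow i p",
          OF sub infT])
      (fold G_def, rule GP'[OF that], simp add: K_def)
  then have nilP: "nil_part p \<in> ?P" if "p \<in> ?P" for p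
    using that by (simp add: div_pow_def)
  have "bracket x p \<in> ?P" if "p \<in> ?P" for p
    using subspace_add[OF sub nilP[OF that] DP'[OF that, of "\<lambda>l. l"]] by (simp add: nil_part_def)
  with sub comm dim MP' show ?thesis by blast
qed

end

section \<open>From commutative subspaces to abelian ideals\<close>

locale alg_closed_lie_algebra = fd_lie_algebra scale bracket Basis + alg_closed_char_0_space scale Basis
  for scale :: "'k::{alg_closed_field, field_char_0} \<Rightarrow> 'a::ab_group_add \<Rightarrow> 'a" (infixr \<open>*s\<close> 75)
    and bracket Basis
begin

lemma extend_normalizer:
  assumes P: "subspace P" "commutative P"
    and M: "subspace M" "\<And>v. v \<in> M \<Longrightarrow> bracket x v \<in> M"
    and MP: "\<And>y p. y \<in> M \<Longrightarrow> p \<in> P \<Longrightarrow> bracket y p \<in> P"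
  shows "\<exists>P'. subspace P' \<and> commutative P' \<and> dim P \<le> dim P' \<and>
    (\<forall>y\<in>M. \<forall>p\<in>P'. bracket y p \<in> P') \<and> (\<forall>p\<in>P'. bracket x p \<in> P')"
proof -
  from ex_functional_calculus[of "bracket x", OF bracket_linear_right]
  obtain S D where "functional_calculus (bracket x) S D" by (elim exE)
  then interpret ad_weights scale bracket Basis x S D
    by unfold_locales
  obtain Q where Q: "subspace Q" "commutative Q" "dim P \<le> dim Q"
    "\<And>y p. y \<in> M \<Longrightarrow> p \<in> Q \<Longrightarrow> bracket y p \<in> Q" "\<And>f p. p \<in> Q \<Longrightarrow> D f p \<in> Q"
    using semisimple_limit[OF P M MP] by blast
  obtain P' where P': "subspace P'" "commutative P'" "dim Q \<le> dim P'"
    "\<forall>y\<in>M. \<forall>p\<in>P'. bracket y p \<in> P'" "\<forall>p\<in>P'. bracket x p \<in> P'"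
    using nilpotent_limit[OF Q(1,2) M Q(4,5)] by blast
  with le_trans[OF Q(3) P'(3)] show ?thesis by blast
qed

lemma subspace_derived_series: "subspace (derived_series n)"
  by (cases n) simp_all

lemma derived_series_Suc_subset: "derived_series (Suc n) \<subseteq> derived_series n"
proof (induction n)
  case (Suc n)
  have "derived_series (Suc (Suc n)) \<subseteq>
      span {bracket x y | x y. x \<in> derived_series n \<and> y \<in> derived_series n}"
    unfolding derived_series.simps(2)[of "Suc n"] by (rule span_mono) (use Suc in blast)
  then show ?case by (simp only: derived_series.simps(2)[of n])
qed simp

text \<open>A subspace normalized by \<open>derived_series 0\<close>, the whole algebra, is an
  ideal; each enlargement of the normalizing subspace keeps commutativity and does not lower the
  dimension.\<close>

lemma commutative_ideal_of_dim_ge: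
  assumes "solvable" and P: "subspace P" "commutative P"
  shows "\<exists>I. lie_ideal I \<and> commutative I \<and> dim P \<le> dim I"
proof -
  define good where "good N \<longleftrightarrow> (\<exists>P'. subspace P' \<and> commutative P' \<and> dim P \<le> dim P' \<and>
    (\<forall>y\<in>N. \<forall>p\<in>P'. bracket y p \<in> P'))" for N
  obtain n where n: "derived_series n = {0}" using assms(1) unfolding solvable_def by blast
  have "good (derived_series i)" if "i \<le> n" for i
    using that
  \<comment> \<open>Downward induction on \<open>i\<close>: from the zero subspace at
    \<open>n\<close>, which normalizes everything, to the whole algebra at 0.\<close>
  proof (induction i rule: inc_induct)
    case base
    show ?case unfolding good_def n using P by (auto simp: bracket_left subspace_0)
  next
    case (step m)
    let ?N = "derived_series (Suc m)" and ?L = "derived_series m"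
    note N_le = derived_series_Suc_subset[of m] and subL = subspace_derived_series[of m]
    have good_span: "good (span (?N \<union> F))" if "finite F" "F \<subseteq> ?L" for F
      using that
    proof (induction F rule: finite_induct)
      case empty
      have "span ?N = ?N" using subspace_derived_series by (simp only: span_eq_iff)
      with step.IH show ?case by (simp only: Un_empty_right)
    next
      case (insert x F)
      let ?M = "span (?N \<union> F)"
      have M_le: "?M \<subseteq> ?L" by (rule span_minimal[OF _ subL]) (use N_le insert.prems in blast)
      \<comment> \<open>Brackets within \<open>derived_series m\<close> fall into the next term,
        which every intermediate span contains, so \<open>x\<close> normalizes \<open>?M\<close>
        whatever \<open>F\<close> is.\<close>
      have xM: "bracket x v \<in> ?M" if "v \<in> ?M" for v
      proof -
        have "x \<in> ?L" "v \<in> ?L" using that M_le insert.prems by blast+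
        then have "bracket x v \<in> ?N"
          unfolding derived_series.simps(2) by (intro span_base) blast
        then show ?thesis by (intro span_base UnI1)
      qed
      from insert obtain Q where "subspace Q" "commutative Q" and dQ: "dim P \<le> dim Q"
        and "\<And>y p. y \<in> ?M \<Longrightarrow> p \<in> Q \<Longrightarrow> bracket y p \<in> Q" unfolding good_def by blast
      from extend_normalizer[OF this(1,2) subspace_span xM this(4)] obtain Q' where
        Q': "subspace Q'" "commutative Q'" "dim Q \<le> dim Q'"
        "\<And>y p. y \<in> ?M \<Longrightarrow> p \<in> Q' \<Longrightarrow> bracket y p \<in> Q'"
        "\<And>p. p \<in> Q' \<Longrightarrow> bracket x p \<in> Q'" by blast
      have "subspace {y. \<forall>p\<in>Q'. bracket y p \<in> Q'}"
        by (rule subspaceI)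
          (simp_all add: bracket_left subspace_0 subspace_add subspace_scale Q'(1))
      moreover have "?N \<union> insert x F \<subseteq> {y. \<forall>p\<in>Q'. bracket y p \<in> Q'}"
      proof
        fix y assume "y \<in> ?N \<union> insert x F"
        then consider "y = x" | "y \<in> ?N \<union> F" by blast
        then have "\<forall>p\<in>Q'. bracket y p \<in> Q'"
        proof cases
          case 1
          then show ?thesis using Q'(5) by (simp only:) blast
        next
          case 2
          show ?thesis by (intro ballI Q'(4) span_base 2)
        qed
        then show "y \<in> {y. \<forall>p\<in>Q'. bracket y p \<in> Q'}" by (simp only: mem_Collect_eq)
      qed
      ultimately have "span (?N \<union> insert x F) \<subseteq> {y. \<forall>p\<in>Q'. bracket y p \<in> Q'}"
        by (rule span_minimal[rotated])
      then have "\<forall>y\<in>span (?N \<union> insert x F). \<forall>p\<in>Q'. bracket y p \<in> Q'"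
        by (simp only: subset_eq mem_Collect_eq)
      moreover have "dim P \<le> dim Q'" using dQ Q'(3) by simp
      ultimately show ?case unfolding good_def using Q'(1,2) by blast
    qed
    obtain F where F: "F \<subseteq> ?L" "independent F" "?L \<subseteq> span F"
      by (rule basis_exists[of ?L]) (rule that)
    have "span (?N \<union> F) \<subseteq> ?L" by (rule span_minimal[OF _ subL]) (use N_le F(1) in blast)
    moreover have "span F \<subseteq> span (?N \<union> F)" by (rule span_mono) blast
    ultimately have "span (?N \<union> F) = ?L" using F(3) by blast
    with good_span[OF finiteI_independent[OF F(2)] F(1)] show ?case by (simp only:)
  qed
  from this[OF le0] obtain I where "subspace I" "commutative I" "dim P \<le> dim I"
    "\<And>y p. p \<in> I \<Longrightarrow> bracket y p \<in> I" unfolding good_def derived_series.simps(1) by blast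
  then show ?thesis unfolding lie_ideal_def by blast
qed

end

section \<open>Commutative polarizations\<close>

lemma real_eq_half_sum_iff: "real a = 1/2 * (real b + real c) \<longleftrightarrow> 2 * a = b + c"
proof -
  have "real a = 1/2 * (real b + real c) \<longleftrightarrow> real (2 * a) = real (b + c)" by auto
  then show ?thesis by (simp only: of_nat_eq_iff)
qed

context fd_lie_algebra
begin

lemma index_attained: "\<exists>f\<in>dual. dim (radical f) = index"
proof -
  have "(\<lambda>_. 0) \<in> dual"
    unfolding dual_def Vector_Spaces.linear_iff
    by (simp add: vector_space_axioms) (unfold_locales, simp_all add: algebra_simps)
  then have "\<exists>n. \<exists>f\<in>dual. n = dim (radical f)" by blast
  from LeastI_ex[OF this] show ?thesis unfolding index_def by metis
qed

lemma index_le: "f \<in> dual \<Longrightarrow> index \<le> dim (radical f)"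
  unfolding index_def by (rule Least_le) blast

lemma commutative_dim_le:
  assumes "subspace P" "commutative P"
  shows "2 * dim P \<le> dim UNIV + index"
proof -
  obtain f where f: "f \<in> dual" "dim (radical f) = index" using index_attained by blast
  have "2 * dim P \<le> dim UNIV + dim (radical f)"
    by (rule isotropic_dim_le[OF f(1) assms(1)])
      (use assms(2) in \<open>simp add: commutative_def dualD(4)[OF f(1)]\<close>)
  with f(2) show ?thesis by (simp only:)
qed

text \<open>A CP could a priori belong to a form f with dim L(f) above the index; the bound for
  commutative subspaces forces equality. Conversely every form vanishes on [P, P] = 0, so one
  attaining the index serves as witness.\<close>

lemma CP_iff: "CP P \<longleftrightarrow> subspace P \<and> commutative P \<and> 2 * dim P = dim UNIV + index"
proof (intro iffI conjI)
  assume "CP P"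
  then obtain f where P: "subspace P" "commutative P" and f: "f \<in> dual"
    "2 * dim P = dim UNIV + dim (radical f)"
    unfolding CP_def polarization_def lie_subalgebra_def real_eq_half_sum_iff by blast
  show "subspace P" "commutative P" by fact+
  show "2 * dim P = dim UNIV + index"
    using f(2) index_le[OF f(1)] commutative_dim_le[OF P] by linarith
next
  assume P: "subspace P \<and> commutative P \<and> 2 * dim P = dim UNIV + index"
  obtain f where f: "f \<in> dual" "dim (radical f) = index" using index_attained by blast
  have "lie_subalgebra P"
    using P unfolding lie_subalgebra_def commutative_def by (auto simp: subspace_0)
  moreover have "polarization f P"
    using P f calculation unfolding polarization_def commutative_def real_eq_half_sum_iff
    by (simp add: dualD(4)[OF f(1)])
  ultimately show "CP P" unfolding CP_def using P f(1) by blast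
qed

lemma max_abelian_ideal_dim_ge:
  assumes "lie_ideal I" "commutative I"
  shows "dim I \<le> max_abelian_ideal_dim"
  unfolding max_abelian_ideal_dim_def
proof (rule Max_ge)
  show "finite {dim I | I. lie_ideal I \<and> commutative I}"
    by (rule finite_subset[of _ "{..dim UNIV}"]) (auto intro: dim_subset simp del: dim_UNIV)
qed (use assms in blast)

lemma max_abelian_ideal_dim_attained:
  "\<exists>I. lie_ideal I \<and> commutative I \<and> dim I = max_abelian_ideal_dim"
proof -
  let ?X = "{dim I | I. lie_ideal I \<and> commutative I}"
  have "finite ?X"
    by (rule finite_subset[of _ "{..dim UNIV}"]) (auto intro: dim_subset simp del: dim_UNIV)
  moreover have "lie_ideal {0} \<and> commutative {0}"
    unfolding lie_ideal_def commutative_def by (simp add: bracket_right)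
  then have "?X \<noteq> {}" by blast
  ultimately have "Max ?X \<in> ?X" by (rule Max_in)
  then show ?thesis unfolding max_abelian_ideal_dim_def by auto
qed

lemma ex_CP_ideal_iff: "(\<exists>P. CP_ideal P) \<longleftrightarrow> 2 * max_abelian_ideal_dim = dim UNIV + index"
proof
  assume "\<exists>P. CP_ideal P"
  then obtain P where P: "lie_ideal P" "commutative P" "2 * dim P = dim UNIV + index"
    unfolding CP_ideal_def CP_iff by blast
  obtain I where I: "lie_ideal I" "commutative I" "dim I = max_abelian_ideal_dim"
    using max_abelian_ideal_dim_attained by blast
  have "2 * dim I \<le> dim UNIV + index"
    using I(1,2) by (intro commutative_dim_le) (auto simp: lie_ideal_def)
  with max_abelian_ideal_dim_ge[OF P(1,2)] P(3) I(3)
  show "2 * max_abelian_ideal_dim = dim UNIV + index" by linarith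
next
  assume "2 * max_abelian_ideal_dim = dim UNIV + index"
  with max_abelian_ideal_dim_attained show "\<exists>P. CP_ideal P"
    unfolding CP_ideal_def CP_iff lie_ideal_def by metis
qed

end

text \<open>An abelian ideal at least as large as a CP attains the upper bound for commutative
  subspaces, which makes it a CP.\<close>

lemma (in alg_closed_lie_algebra) ex_CP_iff_ex_CP_ideal:
  assumes "solvable"
  shows "(\<exists>P. CP P) \<longleftrightarrow> (\<exists>P. CP_ideal P)"
proof
  assume "\<exists>P. CP P"
  then obtain P where P: "subspace P" "commutative P" "2 * dim P = dim UNIV + index"
    unfolding CP_iff by blast
  obtain I where I: "lie_ideal I" "commutative I" "dim P \<le> dim I"
    using commutative_ideal_of_dim_ge[OF assms P(1,2)] by blast
  have "subspace I" using I(1) unfolding lie_ideal_def by blast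
  with commutative_dim_le[OF this I(2)] I P(3) have "CP_ideal I"
    unfolding CP_ideal_def CP_iff by linarith
  then show "\<exists>P. CP_ideal P" by blast
qed (auto simp: CP_ideal_def)

theorem theorem4p1:
  fixes scale :: "'k::{alg_closed_field, field_char_0} \<Rightarrow> 'a::ab_group_add \<Rightarrow> 'a"
    and bracket :: "'a \<Rightarrow> 'a \<Rightarrow> 'a"
  assumes "lie_algebra scale bracket"
    and "\<exists>Basis. finite_dimensional_vector_space scale Basis"
    and "lie_algebra.solvable scale bracket"
  defines "m \<equiv> lie_algebra.max_abelian_ideal_dim scale bracket"
  shows "((\<exists>P. lie_algebra.CP scale bracket P) \<longleftrightarrow> (\<exists>P. lie_algebra.CP_ideal scale bracket P)) \<and>
    ((\<exists>P. lie_algebra.CP_ideal scale bracket P) \<longleftrightarrow>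
      real m = 1/2 * (real (vector_space.dim scale UNIV) + real (lie_algebra.index scale bracket)))"
proof -
  obtain Basis where "finite_dimensional_vector_space scale Basis" using assms(2) by blast
  with assms(1) interpret alg_closed_lie_algebra scale bracket Basis
    by (simp add: alg_closed_lie_algebra_def fd_lie_algebra_def alg_closed_char_0_space_def)
  show ?thesis
    using ex_CP_iff_ex_CP_ideal[OF assms(3)] ex_CP_ideal_iff
    unfolding m_def real_eq_half_sum_iff by blast
qed

end
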